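(* Let $k\ge 1$ be an integer. The atoms $A_\lambda^{(k)}[X;t]$, indexed by all $k$-bounded partitions $\lambda$, are linearly independent, and each has an expansion of the form $$A_\lambda^{(k)}[X;t]=S_\lambda[X]+\sum_{\mu>\lambda}v_{\mu\lambda}^{(k)}(t)\,S_\mu[X],\qquad v_{\mu\lambda}^{(k)}(t)\in\mathbb N[t],$$ where $>$ denotes (strict) dominance order on partitions of $|\lambda|$.
   Context: Symmetric functions have coefficients in $\mathbb Q(q,t)$. Dominance order: for $|\lambda|=|\mu|$, $\lambda\le\mu$ iff $\lambda_1+\cdots+\lambda_i\le\mu_1+\cdots+\mu_i$ for all $i$. Tableaux. Diagrams of partitions are drawn with row $i$ (counted from the bottom) of length $\lambda_i$. $\ell(\lambda)$ is the number of nonzero parts, and $\lambda$ is $k$-bounded if $\lambda_1\le k$. A tableau is a filling of a partition diagram by positive integers, nondecreasing along rows (left to right) and strictly increasing up columns. It is identified with its reading word, obtained by reading rows left to right, from the top row to the bottom row. The evaluation of a word is $(\rho_1,\rho_2,\dots)$, $\rho_i$ being the number of letters $i$. $\equiv$ denotes Knuth (plactic) equivalence: $acb\equiv cab$ for $a\le b<c$ and $bac\equiv bca$ for $a<b\le c$. Every word is Knuth equivalent to a unique tableau. $\mathbb H_0$ is the empty tableau. Sets of tableaux are identified with formal sums of their elements, and operators are extended linearly. Symmetric group action. $\sigma_i$ acts on a word through its subword in the letters $i,i+1$: successively pair every factor $(i+1)\,i$ (ignoring already paired letters) until the unpaired letters form $i^r(i+1)^s$; replace these by $i^s(i+1)^r$.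 This gives an action of the symmetric group on words, sending tableaux to tableaux of the same shape. Promotion. For $T$ of evaluation $(\lambda_1,\dots,\lambda_m)$, $\mathbb B_r(T)=\sigma_1\cdots\sigma_m\,\mathbb R_r T$, where $\mathbb R_rT$ is the sum of all tableaux obtained by adding to $T$ a horizontal $r$-strip of letters $m+1$. Filtering. The main hook-length is $h_M(\lambda)=\lambda_1+\ell(\lambda)-1$. The $k$-split of a $k$-bounded $\lambda$ is the sequence $\lambda^{\to k}=(\lambda^{(1)},\dots,\lambda^{(r)})$ obtained by cutting $\lambda$ (keeping the order of its parts) into consecutive partitions with $h_M(\lambda^{(i)})=k$ for all $i\ne r$ (the last one may have main hook-length less than $k$). For a tableau $T$ whose shape contains $\lambda$, let $T_\lambda$ be its subtableau of shape $\lambda$, $T_1$ the part of $T$ outside $T_\lambda$ in the first $\ell(\lambda)$ rows, $T_2$ the part of $T$ above those rows, and $\overline T$ the unique tableau Knuth equivalent to the word $T_1T_2$ (reading word of $T_1$ followed by that of $T_2$). $S(\lambda)$ is the set of tableaux of shape $\lambda$ and evaluation $(0^m,\lambda_1,\lambda_2,\dots)$, $m\in\mathbb N$. The restricted $\lambda$-katabolism is $\overline{\mathbb K}_\lambda(T)=\overline T$ if $\lambda\subseteq\mathrm{shape}(T)$ and $T_\lambda\in S(\lambda)$, and $0$ otherwise. For $S=(\lambda^{(1)},\dots,\lambda^{(r)})$, $\mathbb P_S(T)=T$ if $\overline{\mathbb K}_{\lambda^{(r)}}\cdots\overline{\mathbb K}_{\lambda^{(1)}}(T)=\mathbb H_0$,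 and $0$ otherwise. Super atoms. $\mathbb A^{(k)}_0=\mathbb H_0$ and, for a $k$-bounded partition $\lambda$, $\mathbb A_\lambda^{(k)}=\mathbb P_{\lambda^{\to k}}\,\mathbb B_{\lambda_1}\big(\mathbb A^{(k)}_{(\lambda_2,\lambda_3,\dots)}\big)$. Charge. For a word $w$ whose evaluation is a partition: read $w$ from right to left, cyclically. Starting at the right end with label $\ell=0$, label with $\ell$ the first $1$ met, then the first $2$ met after it, then the first $3$ after that, etc., increasing $\ell$ by $1$ each time one passes from the left end of $w$ back to its right end. When the letters are exhausted repeat on the unlabeled letters, again from the right end with $\ell=0$, until all letters are labeled. $\mathrm{charge}(w)$ is the sum of the labels. If the evaluation is not a partition, first apply a permutation $\sigma$ (via the $\sigma_i$) making it one and set $\mathrm{charge}(w)=\mathrm{charge}(\sigma w)$. Atoms. $S_\lambda[X]$ is the Schur function in $X=x_1+x_2+\cdots$. $\digamma$ is the linear map $\digamma(T)=t^{\mathrm{charge}(T)}S_{\mathrm{shape}(T)}[X]$, and $A_\lambda^{(k)}[X;t]=\digamma(\mathbb A_\lambda^{(k)})$. *)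

theory Defs
  imports
    "HOL-Library.Multiset"
    "HOL-Library.Function_Algebras"
    "HOL-Computational_Algebra.Polynomial"
    "HOL-Computational_Algebra.Fraction_Field"
begin

subsection \<open>Partitions\<close>

text \<open>Partitions are lists of their nonzero parts, largest part first.\<close>

definition is_partition :: "nat list \<Rightarrow> bool" where
  "is_partition l \<longleftrightarrow> sorted_wrt (\<ge>) l \<and> (\<forall>x\<in>set l. 0 < x)"

definition k_bounded :: "nat \<Rightarrow> nat list \<Rightarrow> bool" where
  "k_bounded k l \<longleftrightarrow> is_partition l \<and> (\<forall>x\<in>set l. x \<le> k)"

definition part :: "nat list \<Rightarrow> nat \<Rightarrow> nat" where
  "part l i = (if i < length l then l ! i else 0)"

definition contained :: "nat list \<Rightarrow> nat list \<Rightarrow> bool" where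
  "contained l m \<longleftrightarrow> (\<forall>i. part l i \<le> part m i)"

definition dominated :: "nat list \<Rightarrow> nat list \<Rightarrow> bool" where
  "dominated l m \<longleftrightarrow>
     sum_list l = sum_list m \<and> (\<forall>i. sum_list (take i l) \<le> sum_list (take i m))"

definition strictly_dominated :: "nat list \<Rightarrow> nat list \<Rightarrow> bool" where
  "strictly_dominated l m \<longleftrightarrow> dominated l m \<and> l \<noteq> m"

subsection \<open>Words and tableaux\<close>

text \<open>
  A tableau is the list of its rows, bottom row (the longest one) first;
  row and column indices start at 0. The empty tableau is \<open>[]\<close>.
\<close>

type_synonym tableau = "nat list list"

definition is_tableau :: "tableau \<Rightarrow> bool" where
  "is_tableau T \<longleftrightarrow>
     (\<forall>r\<in>set T. r \<noteq> [] \<and> sorted r \<and> (\<forall>x\<in>set r. 0 < x)) \<and>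
     (\<forall>i. Suc i < length T \<longrightarrow>
        length (T ! Suc i) \<le> length (T ! i) \<and>
        (\<forall>j<length (T ! Suc i). T ! i ! j < T ! Suc i ! j))"

definition shape :: "tableau \<Rightarrow> nat list" where
  "shape T = map length T"

text \<open>Also used for skew fillings, some rows of which may be empty.\<close>

definition reading :: "tableau \<Rightarrow> nat list" where
  "reading T = concat (rev T)"

definition max_letter :: "nat list \<Rightarrow> nat" where
  "max_letter w = Max (insert 0 (set w))"

text \<open>The entry at index \<open>i\<close> counts the letter \<open>Suc i\<close>; there are no trailing zeros.\<close>

definition evaluation :: "nat list \<Rightarrow> nat list" where
  "evaluation w = map (count_list w) [1..<Suc (max_letter w)]"

inductive knuth_step :: "nat list \<Rightarrow> nat list \<Rightarrow> bool" where
  "a \<le> b \<Longrightarrow> b < c \<Longrightarrow> knuth_step (u @ [a, c, b] @ v) (u @ [c, a, b] @ v)"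
| "a < b \<Longrightarrow> b \<le> c \<Longrightarrow> knuth_step (u @ [b, a, c] @ v) (u @ [b, c, a] @ v)"

definition knuth_equiv :: "nat list \<Rightarrow> nat list \<Rightarrow> bool" where
  "knuth_equiv = equivclp knuth_step"

definition tableau_of_word :: "nat list \<Rightarrow> tableau" where
  "tableau_of_word w = (THE T. is_tableau T \<and> knuth_equiv (reading T) w)"

subsection \<open>Symmetric group action\<close>

text \<open>
  The list argument holds (position, letter) pairs for the letters \<open>i\<close>, \<open>i + 1\<close>; the first
  argument is the stack (top first) of scanned letters that are still unpaired. Each time the
  stack top \<open>i + 1\<close> and the next letter \<open>i\<close> form a factor, the two are paired and dropped.
\<close>

fun unpaired :: "nat \<Rightarrow> (nat \<times> nat) list \<Rightarrow> (nat \<times> nat) list \<Rightarrow> (nat \<times> nat) list" where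
  "unpaired i st [] = rev st"
| "unpaired i [] (x # xs) = unpaired i [x] xs"
| "unpaired i (y # st) (x # xs) =
     (if snd y = Suc i \<and> snd x = i then unpaired i st xs else unpaired i (x # y # st) xs)"

definition sigma_word :: "nat \<Rightarrow> nat list \<Rightarrow> nat list" where
  "sigma_word i w =
     (let us = unpaired i [] (filter (\<lambda>(p, a). a = i \<or> a = Suc i) (List.enumerate 0 w));
          r = count_list (map snd us) i;
          s = count_list (map snd us) (Suc i)
      in fold (\<lambda>(p, a) v. v[p := a])
           (zip (map fst us) (replicate s i @ replicate r (Suc i))) w)"

fun split_lengths :: "nat list \<Rightarrow> nat list \<Rightarrow> nat list list" where
  "split_lengths [] w = []"
| "split_lengths (n # ns) w = take n w # split_lengths ns (drop n w)"

text \<open>The action on the reading word of \<open>T\<close>, written back into the shape of \<open>T\<close>.\<close>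

definition sigma :: "nat \<Rightarrow> tableau \<Rightarrow> tableau" where
  "sigma i T = rev (split_lengths (rev (shape T)) (sigma_word i (reading T)))"

subsection \<open>Operators on formal sums of tableaux\<close>

text \<open>
  Formal sums of tableaux with coefficients in \<open>\<nat>\<close> are multisets. An operator is given by its
  values on single tableaux and extended by \<open>extend\<close>.
\<close>

definition extend :: "(tableau \<Rightarrow> tableau multiset) \<Rightarrow> tableau multiset \<Rightarrow> tableau multiset" where
  "extend f A = (\<Sum>T\<in>#A. f T)"

definition horizontal_strip :: "nat list \<Rightarrow> nat list \<Rightarrow> nat \<Rightarrow> bool" where
  "horizontal_strip m l r \<longleftrightarrow>
     contained l m \<and> (\<forall>i. part m (Suc i) \<le> part l i) \<and> sum_list m = sum_list l + r"

definition add_strip :: "nat \<Rightarrow> tableau \<Rightarrow> tableau set" where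
  "add_strip r T =
     {T'. is_tableau T' \<and> horizontal_strip (shape T') (shape T) r \<and>
          (\<forall>i<length T'. T' ! i =
             (if i < length T then T ! i else []) @
             replicate (part (shape T') i - part (shape T) i) (Suc (max_letter (reading T))))}"

text \<open>\<open>\<sigma>\<^sub>1 \<cdots> \<sigma>\<^sub>m\<close> applies \<open>\<sigma>\<^sub>m\<close> first.\<close>

definition promotion :: "nat \<Rightarrow> tableau \<Rightarrow> tableau multiset" where
  "promotion r T =
     image_mset (foldr sigma [1..<Suc (max_letter (reading T))]) (mset_set (add_strip r T))"

definition main_hook :: "nat list \<Rightarrow> nat" where
  "main_hook l = hd l + length l - 1"

definition is_k_split :: "nat \<Rightarrow> nat list \<Rightarrow> nat list list \<Rightarrow> bool" where
  "is_k_split k l S \<longleftrightarrow>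
     concat S = l \<and> (\<forall>m\<in>set S. m \<noteq> []) \<and>
     (\<forall>m\<in>set (butlast S). main_hook m = k) \<and> (S \<noteq> [] \<longrightarrow> main_hook (last S) \<le> k)"

definition k_split :: "nat \<Rightarrow> nat list \<Rightarrow> nat list list" where
  "k_split k l = (THE S. is_k_split k l S)"

definition superstandard :: "nat list \<Rightarrow> tableau set" where
  "superstandard l =
     {T. is_tableau T \<and> shape T = l \<and> (\<exists>m. evaluation (reading T) = replicate m 0 @ l)}"

text \<open>
  For \<open>l\<close> contained in the shape of \<open>T\<close>, the three parts of \<open>T\<close> are \<open>map2 take l T\<close> (the
  subtableau of shape \<open>l\<close>), \<open>map2 drop l T\<close> and \<open>drop (length l) T\<close>.
\<close>

definition katabolism :: "nat list \<Rightarrow> tableau \<Rightarrow> tableau multiset" where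
  "katabolism l T =
     (if contained l (shape T) \<and> map2 take l T \<in> superstandard l
      then {#tableau_of_word (reading (map2 drop l T) @ reading (drop (length l) T))#}
      else {#})"

definition filtering :: "nat list list \<Rightarrow> tableau \<Rightarrow> tableau multiset" where
  "filtering S T = (if fold (extend \<circ> katabolism) S {#T#} = {#[]#} then {#T#} else {#})"

fun super_atom :: "nat \<Rightarrow> nat list \<Rightarrow> tableau multiset" where
  "super_atom k [] = {#[]#}"
| "super_atom k (r # l) =
     extend (filtering (k_split k (r # l))) (extend (promotion r) (super_atom k l))"

subsection \<open>Charge\<close>

text \<open>
  \<open>charge_pass a l xs ys\<close>: the letter to be labeled next is \<open>a\<close>, the current label is \<open>l\<close>, and
  \<open>ys @ xs\<close> are the unlabeled letters in the order in which they are read (so the word from right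
  to left), of which \<open>ys\<close> have already been passed since the last start from the right end.
  The result is the sum of the labels given and the remaining unlabeled letters.
\<close>

function charge_pass :: "nat \<Rightarrow> nat \<Rightarrow> nat list \<Rightarrow> nat list \<Rightarrow> nat \<times> nat list" where
  "charge_pass a l xs ys =
     (if a \<in> set xs then
        map_prod ((+) l) id
          (charge_pass (Suc a) l
             (tl (dropWhile (\<lambda>x. x \<noteq> a) xs)) (ys @ takeWhile (\<lambda>x. x \<noteq> a) xs))
      else if a \<in> set ys then
        map_prod ((+) (Suc l)) id
          (charge_pass (Suc a) (Suc l)
             (tl (dropWhile (\<lambda>x. x \<noteq> a) ys) @ xs) (takeWhile (\<lambda>x. x \<noteq> a) ys))
      else (0, ys @ xs))"
  by pat_completeness auto

lemma length_remove_first: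
  "a \<in> set xs \<Longrightarrow>
   length (tl (dropWhile (\<lambda>x. x \<noteq> a) xs)) + length (takeWhile (\<lambda>x. x \<noteq> a) xs) < length xs"
  by (induction xs) auto

termination
proof (relation "measure (\<lambda>(a, l, xs, ys). length xs + length ys)", goal_cases)
  case 1
  show ?case by simp
next
  case (2 a l xs ys)
  then show ?case using length_remove_first[of a xs] by simp
next
  case (3 a l xs ys)
  then show ?case using length_remove_first[of a ys] by simp
qed

declare charge_pass.simps [simp del]

lemma length_charge_pass: "length (snd (charge_pass a l xs ys)) \<le> length xs + length ys"
proof (induction a l xs ys rule: charge_pass.induct)
  case (1 a l xs ys)
  show ?case
    using 1 length_remove_first[of a xs] length_remove_first[of a ys]
    by (subst charge_pass.simps) auto
qed

lemma length_charge_pass_less: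
  assumes "a \<in> set xs"
  shows "length (snd (charge_pass a l xs [])) < length xs"
  using assms length_remove_first[of a xs]
    length_charge_pass[of "Suc a" l "tl (dropWhile (\<lambda>x. x \<noteq> a) xs)" "takeWhile (\<lambda>x. x \<noteq> a) xs"]
  by (subst charge_pass.simps) auto

function charge_rev :: "nat list \<Rightarrow> nat" where
  "charge_rev xs =
     (if 1 \<in> set xs
      then fst (charge_pass 1 0 xs []) + charge_rev (snd (charge_pass 1 0 xs []))
      else 0)"
  by pat_completeness auto
termination
  by (relation "measure length") (use length_charge_pass_less in auto)

declare charge_rev.simps [simp del]

text \<open>
  If the evaluation is not a partition, some composite of the \<open>\<sigma>\<^sub>i\<close> that makes it one is applied
  first.
\<close>

definition charge :: "nat list \<Rightarrow> nat" where
  "charge w =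
     charge_rev (rev
       (if is_partition (evaluation w) then w
        else (SOME v. is_partition (evaluation v) \<and>
                (\<exists>js. (\<forall>j\<in>set js. 1 \<le> j) \<and> v = fold sigma_word js w))))"

subsection \<open>Symmetric functions and atoms\<close>

text \<open>
  The field \<open>\<rat>(q, t)\<close> is the fraction field of \<open>\<rat>[q][t]\<close>. Formal series in the variables
  \<open>x\<^sub>1, x\<^sub>2, \<dots>\<close> are given by their coefficients at the monomials, a monomial being
  the multiset of the indices of its variables.
\<close>

type_synonym qt = "rat poly poly fract"

type_synonym series = "nat multiset \<Rightarrow> qt"

definition qt_t :: qt where
  "qt_t = Fract [:0, 1:] 1"

definition scale :: "qt \<Rightarrow> series \<Rightarrow> series" where
  "scale c f = (\<lambda>M. c * f M)"

interpretation series: vector_space scale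
  by unfold_locales (auto simp: scale_def fun_eq_iff algebra_simps)

definition schur :: "nat list \<Rightarrow> series" where
  "schur l = (\<lambda>M. of_nat (card {T. is_tableau T \<and> shape T = l \<and> mset (reading T) = M}))"

definition atom :: "nat \<Rightarrow> nat list \<Rightarrow> series" where
  "atom k l = (\<Sum>T\<in>#super_atom k l. scale (qt_t ^ charge (reading T)) (schur (shape T)))"

end

theory Submission
  imports Defs
begin

text \<open>
  Every tableau in the super atom of a partition \<open>\<lambda>\<close> has evaluation \<open>\<lambda>\<close>: a promotion turns the
  evaluation \<open>(\<lambda>\<^sub>2, \<lambda>\<^sub>3, \<dots>)\<close> into \<open>(\<lambda>\<^sub>2, \<lambda>\<^sub>3, \<dots>, \<lambda>\<^sub>1)\<close> and then cycles it, and filtering only discards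
  tableaux (\<open>super_atom_content\<close>). A tableau of evaluation \<open>\<lambda>\<close> has a shape that dominates \<open>\<lambda>\<close>, and the only one
  of shape \<open>\<lambda>\<close> is the tableau \<open>T\<^sub>\<lambda>\<close> whose \<open>j\<close>-th row from the bottom
  consists of letters \<open>j\<close> (\<open>dominated_shape\<close>,
  \<open>row_tableau_unique\<close>). So the atom is a combination, with coefficients in \<open>\<nat>[t]\<close>, of Schur functions of shapes
  dominating \<open>\<lambda>\<close>, and the expansion follows once \<open>T\<^sub>\<lambda>\<close> is known to occur exactly once
  (\<open>count_super_atom_row_tableau\<close>) and to have charge \<open>0\<close> (\<open>charge_row_tableau\<close>).

  The multiplicity of \<open>T\<^sub>\<lambda>\<close> is found by induction on the number of parts. If a promotion of a tableau \<open>T\<close> of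
  evaluation \<open>(\<lambda>\<^sub>2, \<lambda>\<^sub>3, \<dots>)\<close> contains \<open>T\<^sub>\<lambda>\<close>, the strip added to \<open>T\<close> takes one cell from each of the \<open>\<lambda>\<^sub>1\<close>
  columns of \<open>\<lambda>\<close>; hence \<open>T\<close> has shape \<open>(\<lambda>\<^sub>2, \<lambda>\<^sub>3, \<dots>)\<close> and is itself a tableau with constant rows, and the strip is
  unique (\<open>promotion_to_row_tableau\<close>, \<open>count_promotion_row_tableau\<close>). The filter keeps \<open>T\<^sub>\<lambda>\<close>, because each
  katabolism strips off one block of rows (\<open>filtering_row_tableau\<close>). The latter rests on a special case of the
  uniqueness of the tableau in a Knuth class, obtained from the invariance of Yamanouchi words
  (\<open>tableau_of_word_row_tableau\<close>).

  All this needs that the operators \<open>\<sigma>\<^sub>i\<close> map tableaux to tableaux (\<open>sigma_tableau\<close>). For this, the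
  unpaired letters are characterized by counting conditions (\<open>set_unpaired\<close>). These show that unpaired letters
  are contiguous in each row and that a letter \<open>i\<close> directly below a letter \<open>i + 1\<close> is always paired.

  Linear independence is a double triangularity: Schur functions are unitriangular against monomials,
  and atoms are unitriangular against Schur functions (\<open>triangular_imp_zero\<close>).
\<close>

section \<open>Bracketing in words\<close>

definition wt :: "nat \<Rightarrow> nat list \<Rightarrow> int" where
  "wt i w = int (count_list w i) - int (count_list w (Suc i))"

lemma wt_simps [simp]:
  "wt i [] = 0"
  "wt i (u @ v) = wt i u + wt i v"
  "wt i (x # v) = (if x = i then 1 else if x = Suc i then - 1 else 0) + wt i v"
  by (auto simp: wt_def)

text \<open>
  Reading \<open>i + 1\<close> as an opening and \<open>i\<close> as a closing bracket, a letter \<open>i\<close> has no partner iff every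
  suffix of the word to its left holds at least as many \<open>i\<close> as \<open>i + 1\<close> (\<open>left_ok\<close>), and a letter
  \<open>i + 1\<close> has no partner iff no prefix of the word to its right holds more \<open>i\<close> than \<open>i + 1\<close>
  (\<open>right_ok\<close> with start value \<open>0\<close>; the start value makes the condition recursive). Unlike the stack of
  \<open>unpaired\<close>, these conditions can be checked for one letter without tracking the others. The condition
  \<open>left_ok i w\<close> for all \<open>i\<close> also says that \<open>w\<close> is a Yamanouchi word.
\<close>

fun left_ok :: "nat \<Rightarrow> nat list \<Rightarrow> bool" where
  "left_ok i [] = True"
| "left_ok i (x # w) \<longleftrightarrow> 0 \<le> wt i (x # w) \<and> left_ok i w"

fun right_ok :: "nat \<Rightarrow> int \<Rightarrow> nat list \<Rightarrow> bool" where
  "right_ok i c [] \<longleftrightarrow> c \<le> 0"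
| "right_ok i c (x # w) \<longleftrightarrow> c \<le> 0 \<and> right_ok i (c + wt i [x]) w"

lemma left_ok_wt: "left_ok i w \<Longrightarrow> 0 \<le> wt i w"
  by (cases w) auto

lemma right_ok_start: "right_ok i c w \<Longrightarrow> c \<le> 0"
  by (cases w) auto

lemma left_ok_suffix: "left_ok i (u @ v) \<Longrightarrow> 0 \<le> wt i v"
  by (induction u) (auto dest: left_ok_wt)

lemma right_ok_prefix: "right_ok i c (u @ v) \<Longrightarrow> c + wt i u \<le> 0"
proof (induction u arbitrary: c)
  case (Cons x u)
  then have "c + wt i [x] + wt i u \<le> 0" by (intro Cons.IH) simp
  then show ?case by simp
qed (auto dest: right_ok_start)

lemma right_ok_mono: "right_ok i c w \<Longrightarrow> d \<le> c \<Longrightarrow> right_ok i d w"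
proof (induction w arbitrary: c d)
  case (Cons x w)
  have "right_ok i (d + wt i [x]) w"
    using Cons.IH[of "c + wt i [x]" "d + wt i [x]"] Cons.prems by simp
  then show ?case using Cons.prems by simp
qed auto

lemma left_ok_cancel: "left_ok i (u @ Suc i # i # v) \<longleftrightarrow> left_ok i (u @ v)"
  by (induction u) (auto dest: left_ok_wt)

lemma right_ok_cancel: "right_ok i c (u @ Suc i # i # v) \<longleftrightarrow> right_ok i c (u @ v)"
  by (induction u arbitrary: c) (auto dest: right_ok_start)

lemma left_ok_filter: "left_ok i (filter (\<lambda>a. a = i \<or> a = Suc i) w) \<longleftrightarrow> left_ok i w"
proof (induction w)
  case (Cons x w)
  have "wt i (filter (\<lambda>a. a = i \<or> a = Suc i) w) = wt i w"
    by (induction w) auto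
  with Cons show ?case by (auto dest: left_ok_wt)
qed simp

lemma right_ok_filter: "right_ok i c (filter (\<lambda>a. a = i \<or> a = Suc i) w) \<longleftrightarrow> right_ok i c w"
  by (induction w arbitrary: c) (auto dest: right_ok_start)

lemma left_ok_replicate: "left_ok i u \<Longrightarrow> \<forall>x\<in>set v. x = i \<Longrightarrow> left_ok i (u @ v)"
proof (induction u)
  case Nil
  then show ?case
  proof (induction v)
    case (Cons x v)
    then show ?case using left_ok_wt[of i v] by auto
  qed simp
next
  case (Cons x u)
  have "0 \<le> wt i v" using Cons.prems(2) by (induction v) auto
  with Cons show ?case by auto
qed

lemma right_ok_replicate: "right_ok i c v \<Longrightarrow> \<forall>x\<in>set u. x = Suc i \<Longrightarrow> right_ok i c (u @ v)"
proof (induction u arbitrary: c)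
  case (Cons x u)
  have "right_ok i (c - 1) (u @ v)"
    using Cons.IH[of "c - 1"] right_ok_mono[OF Cons.prems(1), of "c - 1"] Cons.prems(2) by simp
  with Cons.prems show ?case by (auto dest: right_ok_start)
qed simp

definition free :: "nat \<Rightarrow> (nat \<times> nat) list \<Rightarrow> nat \<times> nat \<Rightarrow> bool" where
  "free i xs z \<longleftrightarrow> (\<exists>ys zs. xs = ys @ z # zs \<and>
     (if snd z = i then left_ok i (map snd ys) else right_ok i 0 (map snd zs)))"

lemma append_eq_append_Cons_conv: 
  "u @ v = ys @ z # zs \<longleftrightarrow> (\<exists>us. u = ys @ z # us \<and> zs = us @ v) \<or> (\<exists>vs. ys = u @ vs \<and> v = vs @ z # zs)"
  by (auto simp: append_eq_append_conv2 append_eq_Cons_conv Cons_eq_append_conv)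

text \<open>
  The bracket criterion is insensitive to the removal of an adjacent pair: such a pair contributes
  \<open>0\<close> to every count that contains both letters, its letters fail the criterion because of each
  other, and a suffix or prefix that cuts through the pair gives no stronger condition than one
  that avoids it.
\<close>

lemma free_cancel:
  assumes "snd y = Suc i" "snd x = i"
  shows "free i (u @ y # x # v) z \<longleftrightarrow> free i (u @ v) z"
proof
  assume "free i (u @ y # x # v) z"
  then obtain ys zs where e: "u @ y # x # v = ys @ z # zs"
    and ok: "if snd z = i then left_ok i (map snd ys) else right_ok i 0 (map snd zs)"
    unfolding free_def by blast
  consider us where "u = ys @ z # us" "zs = us @ y # x # v"
    | "ys = u" "z = y" "zs = x # v"
    | "ys = u @ [y]" "z = x" "zs = v"
    | vs where "ys = u @ y # x # vs" "v = vs @ z # zs"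
    using e unfolding append_eq_append_Cons_conv by (auto simp: Cons_eq_append_conv)
  then show "free i (u @ v) z"
  proof cases
    case 1
    with ok assms show ?thesis unfolding free_def
      by (intro exI[of _ ys] exI[of _ "us @ v"])
         (auto simp: right_ok_cancel[of i _ "map snd us"] split: if_splits)
  next
    case 2
    with ok assms have "right_ok i 1 (map snd v)" by auto
    then show ?thesis using right_ok_start by fastforce
  next
    case 3
    with ok assms have "0 \<le> wt i [Suc i]"
      using left_ok_suffix[of i "map snd u" "[Suc i]"] by auto
    then show ?thesis by simp
  next
    case 4
    with ok assms show ?thesis unfolding free_def
      by (intro exI[of _ "u @ vs"] exI[of _ zs])
         (auto simp: left_ok_cancel[of i "map snd u"] split: if_splits)
  qed
next
  assume "free i (u @ v) z"
  then obtain ys zs where e: "u @ v = ys @ z # zs"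
    and ok: "if snd z = i then left_ok i (map snd ys) else right_ok i 0 (map snd zs)"
    unfolding free_def by blast
  consider us where "u = ys @ z # us" "zs = us @ v"
    | vs where "ys = u @ vs" "v = vs @ z # zs"
    using e unfolding append_eq_append_Cons_conv by auto
  then show "free i (u @ y # x # v) z"
  proof cases
    case 1
    with ok assms show ?thesis unfolding free_def
      by (intro exI[of _ ys] exI[of _ "us @ y # x # v"])
         (auto simp: right_ok_cancel[of i _ "map snd us"] split: if_splits)
  next
    case 2
    with ok assms show ?thesis unfolding free_def
      by (intro exI[of _ "u @ y # x # vs"] exI[of _ zs])
         (auto simp: left_ok_cancel[of i "map snd u"] split: if_splits)
  qed
qed

text \<open>
  The scan only ever removes adjacent pairs from the word formed by the stack and the unread
  letters.
\<close>

lemma free_unpaired: "free i (unpaired i st xs) z \<longleftrightarrow> free i (rev st @ xs) z"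
proof (induction i st xs rule: unpaired.induct)
  case (3 i y st x xs)
  then show ?case using free_cancel[of y i x "rev st" xs z] by auto
qed auto

lemma unpaired_sorted:
  assumes "\<forall>x \<in> set (st @ xs). snd x = i \<or> snd x = Suc i" "sorted (map snd (rev st))"
  shows "sorted (map snd (unpaired i st xs))"
  using assms
proof (induction i st xs rule: unpaired.induct)
  case (3 i y st x xs)
  show ?case
  proof (cases "snd y = Suc i \<and> snd x = i")
    case True
    then show ?thesis using 3 by (simp add: sorted_append)
  next
    case False
    then have yx: "snd y \<le> snd x" using "3.prems"(1) by auto
    moreover have "\<forall>z\<in>set st. snd z \<le> snd y"
      using "3.prems"(2) by (simp add: sorted_append)
    ultimately have "\<forall>z\<in>set st. snd z \<le> snd x" by fastforce
    then have "sorted (map snd (rev (x # y # st)))"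
      using "3.prems"(2) yx by (simp add: sorted_append)
    then have "sorted (map snd (unpaired i (x # y # st) xs))"
      using "3.IH"(2) False "3.prems"(1) by simp
    then show ?thesis using False by auto
  qed
qed auto

lemma unpaired_wt: "wt i (map snd (unpaired i st xs)) = wt i (map snd (rev st @ xs))"
  by (induction i st xs rule: unpaired.induct) auto

lemma unpaired_positions_increasing:
  "sorted_wrt (<) (map fst (rev st @ xs)) \<Longrightarrow> sorted_wrt (<) (map fst (unpaired i st xs))"
  by (induction i st xs rule: unpaired.induct) (auto simp: sorted_wrt_append)

lemma unpaired_subset: "set (unpaired i st xs) \<subseteq> set (st @ xs)"
  by (induction i st xs rule: unpaired.induct) auto

text \<open>
  In a word \<open>i\<^sup>r (i + 1)\<^sup>s\<close>, where the scan ends, all letters satisfy the criterion; hence the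
  surviving letters are exactly the ones that satisfied it at the start.
\<close>

lemma free_all:
  assumes "\<forall>x \<in> set xs. snd x = i \<or> snd x = Suc i" "sorted (map snd xs)" "z \<in> set xs"
  shows "free i xs z"
proof -
  obtain ys zs where e: "xs = ys @ z # zs" using assms(3) by (auto dest: split_list)
  show ?thesis
  proof (cases "snd z = i")
    case True
    then have "\<forall>x\<in>set (map snd ys). x = i" using assms e by (fastforce simp: sorted_append)
    then show ?thesis using e True left_ok_replicate[of i "[]"] unfolding free_def by force
  next
    case False
    then have "snd z = Suc i" using assms e by auto
    then have "\<forall>x\<in>set zs. Suc i \<le> snd x" using assms(2) e by (auto simp: sorted_append)
    then have "snd x = Suc i" if "x \<in> set zs" for x
      using that assms(1) e by (metis Suc_n_not_le_n UnCI list.set_intros(2) set_append)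
    then have "\<forall>x\<in>set (map snd zs). x = Suc i" by simp
    then show ?thesis using e False right_ok_replicate[of i 0 "[]"] unfolding free_def by force
  qed
qed

definition bracket_letters :: "nat \<Rightarrow> nat list \<Rightarrow> (nat \<times> nat) list" where
  "bracket_letters i w = filter (\<lambda>(p, a). a = i \<or> a = Suc i) (List.enumerate 0 w)"

definition free_positions :: "nat \<Rightarrow> nat list \<Rightarrow> nat set" where
  "free_positions i w = {p. p < length w \<and>
     (w ! p = i \<and> left_ok i (take p w) \<or> w ! p = Suc i \<and> right_ok i 0 (drop (Suc p) w))}"

lemma set_unpaired:
  assumes "\<forall>x \<in> set xs. snd x = i \<or> snd x = Suc i"
  shows "set (unpaired i [] xs) = {z. free i xs z}"
proof -
  have "sorted (map snd (unpaired i [] xs))"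
    using unpaired_sorted[of "[]" xs i] assms by auto
  moreover have "\<forall>x \<in> set (unpaired i [] xs). snd x = i \<or> snd x = Suc i"
    using unpaired_subset[of i "[]" xs] assms by auto
  ultimately have "set (unpaired i [] xs) = {z. free i (unpaired i [] xs) z}"
    using free_all[of "unpaired i [] xs" i] by (force simp: free_def)
  then show ?thesis by (simp add: free_unpaired)
qed

lemma map_snd_filter_enumerate:
  "map snd (filter (\<lambda>(p, a). P a) (List.enumerate n w)) = filter P w"
  by (induction w arbitrary: n) auto

lemma bracket_letters_split:
  assumes "p < length w" "w ! p = i \<or> w ! p = Suc i"
  shows "bracket_letters i w =
    filter (\<lambda>(p, a). a = i \<or> a = Suc i) (List.enumerate 0 (take p w)) @ (p, w ! p) #
    filter (\<lambda>(p, a). a = i \<or> a = Suc i) (List.enumerate (Suc p) (drop (Suc p) w))"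
proof -
  have "List.enumerate 0 w = List.enumerate 0 (take p w @ w ! p # drop (Suc p) w)"
    using id_take_nth_drop[OF assms(1)] by simp
  then show ?thesis using assms 
    by (simp add: bracket_letters_def enumerate_append_eq del: append_take_drop_id)
qed

lemma distinct_bracket_letters: "sorted_wrt (<) (map fst (bracket_letters i w))"
  unfolding bracket_letters_def
  by (rule sorted_wrt_map[THEN iffD2], rule sorted_wrt_filter, rule sorted_wrt_map[THEN iffD1])
    simp

lemma free_bracket_letters:
  "free i (bracket_letters i w) z \<longleftrightarrow> fst z \<in> free_positions i w \<and> snd z = w ! fst z"
proof -
  have *: "z \<in> set (bracket_letters i w)" if "free i (bracket_letters i w) z"
    using that by (auto simp: free_def)
  have mem: "z \<in> set (bracket_letters i w) \<longleftrightarrow> fst z < length w \<and> snd z = w ! fst z \<and>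
      (w ! fst z = i \<or> w ! fst z = Suc i)"
    by (cases z) (auto simp: bracket_letters_def in_set_enumerate_eq)
  show ?thesis
  proof (cases "z \<in> set (bracket_letters i w)")
    case False
    then show ?thesis using * mem by (auto simp: free_positions_def)
  next
    case True
    let ?L = "filter (\<lambda>(p, a). a = i \<or> a = Suc i) (List.enumerate 0 (take (fst z) w))"
    let ?R = "filter (\<lambda>(p, a). a = i \<or> a = Suc i)
      (List.enumerate (Suc (fst z)) (drop (Suc (fst z)) w))"
    have e: "bracket_letters i w = ?L @ z # ?R"
      using bracket_letters_split[of "fst z" w i] True mem by (cases z) auto
    have d: "distinct (bracket_letters i w)"
      using strict_sorted_iff distinct_bracket_letters[of i w] distinct_map by blast
    have "ys = ?L \<and> zs = ?R" if "bracket_letters i w = ys @ z # zs" for ys zs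
      using that e d append_Cons_eq_iff[of z ys zs ?L ?R] by auto
    then have "free i (bracket_letters i w) z \<longleftrightarrow>
       (if snd z = i then left_ok i (map snd ?L) else right_ok i 0 (map snd ?R))"
      unfolding free_def using e by blast
    also have "\<dots> \<longleftrightarrow> fst z \<in> free_positions i w \<and> snd z = w ! fst z"
      using True mem 
      by (auto simp: free_positions_def map_snd_filter_enumerate left_ok_filter right_ok_filter)
    finally show ?thesis .
  qed
qed

lemma fold_update_length [simp]:
  "length (fold (\<lambda>(p, a) v. v[p := a]) xs w) = length w"
  by (induction xs arbitrary: w) auto

lemma fold_update_other:
  "p \<notin> set ps \<Longrightarrow> fold (\<lambda>(p, a) v. v[p := a]) (zip ps xs) w ! p = w ! p"
proof (induction ps arbitrary: xs w)
  case (Cons q ps)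
  then show ?case by (cases xs) auto
qed simp

lemma fold_update_at:
  assumes "distinct ps" "length xs = length ps" "n < length ps" "ps ! n < length w"
  shows "fold (\<lambda>(p, a) v. v[p := a]) (zip ps xs) w ! (ps ! n) = xs ! n"
  using assms
proof (induction ps arbitrary: xs w n)
  case (Cons q ps)
  then obtain x xs' where xs: "xs = x # xs'" by (cases xs) auto
  show ?case
  proof (cases n)
    case 0
    then show ?thesis using Cons.prems xs by (auto simp: fold_update_other)
  next
    case (Suc n')
    then show ?thesis using Cons xs by auto
  qed
qed simp

text \<open>
  Written additively to avoid the truncated difference of multisets.
\<close>

lemma fold_update_mset:
  assumes "distinct ps" "length xs = length ps" "\<forall>p\<in>set ps. p < length w"
  shows "mset (fold (\<lambda>(p, a) v. v[p := a]) (zip ps xs) w) + mset (map ((!) w) ps) = mset w + mset xs"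
  using assms
proof (induction ps arbitrary: xs w)
  case (Cons q ps)
  then obtain x xs' where xs: "xs = x # xs'" by (cases xs) auto
  have m: "map ((!) (w[q := x])) ps = map ((!) w) ps"
    using Cons.prems by (auto intro!: nth_list_update_neq)
  have "mset (fold (\<lambda>(p, a) v. v[p := a]) (zip ps xs') (w[q := x])) + mset (map ((!) w) ps)
      = mset (w[q := x]) + mset xs'"
    using Cons.IH[of xs' "w[q := x]"] Cons.prems xs m by auto
  moreover have "mset (w[q := x]) + {#w ! q#} = mset w + {#x#}"
    using Cons.prems by (simp add: mset_update)
  ultimately show ?case using xs by (simp add: ac_simps)
qed simp

text \<open>
  The only facts about the action on words that are used below: letters with a partner stay,
  the other ones keep their positions and form a nondecreasing sequence in \<open>i\<close> and \<open>i + 1\<close>, and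
  the multiplicities of \<open>i\<close> and \<open>i + 1\<close> are exchanged. The last point holds because pairs contain both
  letters equally often.
\<close>

lemma sigma_word_properties:
  fixes i :: nat and w :: "nat list"
  defines "w' \<equiv> sigma_word i w"
  shows "length w' = length w"
    and "\<And>p. p \<notin> free_positions i w \<Longrightarrow> w' ! p = w ! p"
    and "\<And>p. p \<in> free_positions i w \<Longrightarrow> w' ! p = i \<or> w' ! p = Suc i"
    and "\<And>p q. p \<in> free_positions i w \<Longrightarrow> q \<in> free_positions i w \<Longrightarrow> p < q \<Longrightarrow> w' ! p \<le> w' ! q"
    and "count (mset w') a =
      (if a = i then count (mset w) (Suc i) else if a = Suc i then count (mset w) i
       else count (mset w) a)"
proof -
  define us where "us = unpaired i [] (bracket_letters i w)"
  define ps where "ps = map fst us"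
  define r where "r = count_list (map snd us) i"
  define s where "s = count_list (map snd us) (Suc i)"
  define xs where "xs = replicate s i @ replicate r (Suc i)"
  have w': "w' = fold (\<lambda>(p, a) v. v[p := a]) (zip ps xs) w"
    by (simp add: w'_def sigma_word_def us_def ps_def r_def s_def xs_def bracket_letters_def Let_def)
  have br: "\<forall>x\<in>set (bracket_letters i w). snd x = i \<or> snd x = Suc i"
    by (auto simp: bracket_letters_def)
  have us: "set us = {z. fst z \<in> free_positions i w \<and> snd z = w ! fst z}"
    using set_unpaired[OF br] by (simp add: us_def free_bracket_letters)
  have ps: "set ps = free_positions i w"
    by (auto simp: ps_def us image_def)
  have sps: "sorted_wrt (<) ps"
    using unpaired_positions_increasing[of "[]" "bracket_letters i w" i] distinct_bracket_letters
    by (simp add: ps_def us_def)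
  then have dps: "distinct ps" by (simp add: strict_sorted_iff)
  have snds: "map snd us = map ((!) w) ps"
    by (simp add: ps_def us)
  have lets: "set (map snd us) \<subseteq> {i, Suc i}"
    by (auto simp: us free_positions_def)
  then have len: "length xs = length ps"
  proof -
    have "length (map snd us) = r + s"
      using lets unfolding r_def s_def by (induction us) auto
    then show ?thesis by (simp add: xs_def ps_def)
  qed
  have bnd: "\<forall>p\<in>set ps. p < length w" by (auto simp: ps free_positions_def)
  show "length w' = length w" by (simp add: w')
  show "w' ! p = w ! p" if "p \<notin> free_positions i w" for p
    using that by (simp add: w' fold_update_other ps)
  have at: "w' ! (ps ! n) = xs ! n" if "n < length ps" for n
    unfolding w' using that dps len bnd by (intro fold_update_at) auto
  have idx: "\<exists>n<length ps. p = ps ! n" if "p \<in> free_positions i w" for p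
    using that unfolding ps[symmetric] in_set_conv_nth by blast
  show "w' ! p = i \<or> w' ! p = Suc i" if "p \<in> free_positions i w" for p
  proof -
    obtain n where n: "n < length ps" "p = ps ! n" using idx \<open>p \<in> free_positions i w\<close> by blast
    have "xs ! n \<in> set xs" using n len by simp
    then show ?thesis using at n by (auto simp: xs_def)
  qed
  show "w' ! p \<le> w' ! q" if pq: "p \<in> free_positions i w" "q \<in> free_positions i w" "p < q" for p q
  proof -
    obtain n where n: "n < length ps" "p = ps ! n" using idx[OF pq(1)] by blast
    obtain m where m: "m < length ps" "q = ps ! m" using idx[OF pq(2)] by blast
    have "n < m" using sps n m pq
      by (metis linorder_neqE_nat order_less_asym sorted_wrt_nth_less)
    moreover have "sorted xs" by (auto simp: xs_def sorted_append)
    ultimately show ?thesis using n m at len sorted_nth_mono[of xs n m] by auto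
  qed
  have ms: "mset w' + mset (map snd us) = mset w + mset xs"
    using fold_update_mset[OF dps len bnd] by (simp add: w' snds)
  have cnt: "count (mset w') a + count_list (map snd us) a = count (mset w) a + count_list xs a" for a
    using arg_cong[OF ms, of "\<lambda>M. count M a"] by (simp add: count_mset[symmetric] flip: mset_map)
  have "wt i (map snd us) = wt i (map snd (bracket_letters i w))"
    using unpaired_wt[of i "[]"] by (simp add: us_def)
  also have "\<dots> = wt i w"
    unfolding bracket_letters_def map_snd_filter_enumerate by (induction w) auto
  finally have rs: "int r - int s = int (count (mset w) i) - int (count (mset w) (Suc i))"
    by (simp add: wt_def r_def s_def count_mset)
  have "count_list (map snd us) a = 0" if "a \<noteq> i" "a \<noteq> Suc i"
    using that lets by (auto simp: count_list_0_iff)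
  moreover have "count_list xs a = (if a = i then s else if a = Suc i then r else 0)"
    by (auto simp: xs_def simp flip: count_mset)
  ultimately show "count (mset w') a =
      (if a = i then count (mset w) (Suc i) else if a = Suc i then count (mset w) i
       else count (mset w) a)"
    using cnt[of a] rs by (auto simp: r_def[symmetric] s_def[symmetric])
qed

section \<open>The symmetric group action preserves tableaux\<close>

text \<open>
  The index at which row \<open>j\<close> begins in the reading word.
\<close>

definition row_start :: "nat list list \<Rightarrow> nat \<Rightarrow> nat" where
  "row_start T j = sum_list (drop (Suc j) (shape T))"

lemma length_reading: "length (reading T) = sum_list (shape T)"
  by (simp add: reading_def shape_def length_concat rev_map[symmetric] sum_list_rev)

lemma reading_append: "reading (A @ B) = reading B @ reading A"
  by (simp add: reading_def)

lemma reading_Cons: "reading (r # T) = reading T @ r"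
  by (simp add: reading_def)

lemma reading_Nil [simp]: "reading [] = []"
  by (simp add: reading_def)

lemma row_start_length: "row_start T j = length (reading (drop (Suc j) T))"
  by (simp add: row_start_def length_reading) (simp add: shape_def drop_map)

lemma reading_split:
  assumes "j < length T"
  shows "reading T = reading (drop (Suc j) T) @ T ! j @ reading (take j T)"
  by (subst id_take_nth_drop[OF assms]) (simp add: reading_append reading_Cons)

lemma reading_nth:
  assumes "j < length T" "c < length (T ! j)"
  shows "row_start T j + c < length (reading T)"
    and "reading T ! (row_start T j + c) = T ! j ! c"
  using assms(2) by (simp_all add: reading_split[OF assms(1)] row_start_length nth_append)

lemma take_reading:
  assumes "j < length T" "c \<le> length (T ! j)"
  shows "take (row_start T j + c) (reading T) = reading (drop (Suc j) T) @ take c (T ! j)"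
  using assms(2) by (simp add: reading_split[OF assms(1)] row_start_length)

lemma drop_reading:
  assumes "j < length T" "c \<le> length (T ! j)"
  shows "drop (row_start T j + c) (reading T) = drop c (T ! j) @ reading (take j T)"
  using assms(2) by (simp add: reading_split[OF assms(1)] row_start_length)

lemma concat_split_lengths: "sum_list ns = length w \<Longrightarrow> concat (split_lengths ns w) = w"
  by (induction ns w rule: split_lengths.induct) auto

lemma lengths_split_lengths: "sum_list ns = length w \<Longrightarrow> map length (split_lengths ns w) = ns"
  by (induction ns w rule: split_lengths.induct) auto

lemma shape_sigma: "shape (sigma i T) = shape T"
proof -
  have "map length (split_lengths (rev (shape T)) (sigma_word i (reading T))) = rev (shape T)"
    by (rule lengths_split_lengths) (simp add: sum_list_rev length_reading sigma_word_properties(1))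
  then show ?thesis by (simp add: sigma_def shape_def[of "rev _"] flip: rev_map)
qed

lemma reading_sigma: "reading (sigma i T) = sigma_word i (reading T)"
proof -
  have "concat (split_lengths (rev (shape T)) (sigma_word i (reading T))) = sigma_word i (reading T)"
    by (rule concat_split_lengths) (simp add: sum_list_rev length_reading sigma_word_properties(1))
  then show ?thesis by (simp add: sigma_def reading_def[of "rev _"])
qed

lemma sigma_nth:
  assumes "j < length T" "c < length (T ! j)"
  shows "sigma i T ! j ! c = sigma_word i (reading T) ! (row_start T j + c)"
proof -
  have l: "map length (sigma i T) = map length T" using shape_sigma by (simp add: shape_def)
  then have "length (sigma i T) = length T" by (metis length_map)
  moreover have "length (sigma i T ! j) = length (T ! j)"
    using l assms calculation by (metis nth_map)
  ultimately show ?thesis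
    using assms reading_nth(2)[of j "sigma i T" c] by (simp add: reading_sigma row_start_def shape_sigma)
qed

text \<open>
  Used to delimit, in a row of a tableau, the block of letters \<open>i\<close> or \<open>i + 1\<close>.
\<close>

lemma sorted_threshold:
  fixes xs :: "nat list"
  assumes "sorted xs"
  obtains q where "q \<le> length xs" "\<And>d. d < length xs \<Longrightarrow> d < q \<longleftrightarrow> xs ! d < t"
proof -
  have "\<exists>q\<le>length xs. \<forall>d<length xs. d < q \<longleftrightarrow> xs ! d < t"
    using assms
  proof (induction xs)
    case (Cons x xs)
    then obtain q where q: "q \<le> length xs" "\<forall>d<length xs. d < q \<longleftrightarrow> xs ! d < t" by auto
    show ?case
    proof (cases "x < t")
      case True
      then show ?thesis using q by (intro exI[of _ "Suc q"]) (auto simp: nth_Cons split: nat.splits)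
    next
      case False
      then have "\<not> (x # xs) ! d < t" if "d < length (x # xs)" for d
        using sorted_nth_mono[OF Cons.prems, of 0 d] that by auto
      then show ?thesis by (intro exI[of _ 0]) auto
    qed
  qed simp
  then show ?thesis using that by blast
qed

lemma wt_le_length: "wt i w \<le> int (length w)"
  by (induction w) auto

lemma wt_nonpos: "i \<notin> set w \<Longrightarrow> wt i w \<le> 0"
  by (simp add: wt_def count_list_0_iff)

lemma wt_nonneg: "Suc i \<notin> set w \<Longrightarrow> 0 \<le> wt i w"
  by (simp add: wt_def count_list_0_iff)

lemma wt_zero: "i \<notin> set w \<Longrightarrow> Suc i \<notin> set w \<Longrightarrow> wt i w = 0"
  by (simp add: wt_def count_list_0_iff)

lemma wt_const: "\<forall>x\<in>set w. x = i \<Longrightarrow> wt i w = int (length w)"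
  by (induction w) auto

lemma wt_const_Suc: "\<forall>x\<in>set w. x = Suc i \<Longrightarrow> wt i w = - int (length w)"
  by (induction w) auto

lemma set_take_drop_nth:
  "x \<in> set (take n (drop m w)) \<longleftrightarrow> (\<exists>d. m \<le> d \<and> d < m + n \<and> d < length w \<and> w ! d = x)"
proof
  assume "x \<in> set (take n (drop m w))"
  then obtain e where "e < n" "m + e < length w" "x = w ! (m + e)"
    by (auto simp: in_set_conv_nth)
  then show "\<exists>d. m \<le> d \<and> d < m + n \<and> d < length w \<and> w ! d = x"
    by (intro exI[of _ "m + e"]) auto
next
  assume "\<exists>d. m \<le> d \<and> d < m + n \<and> d < length w \<and> w ! d = x"
  then obtain d where "m \<le> d" "d < m + n" "d < length w" "w ! d = x" by blast
  then show "x \<in> set (take n (drop m w))"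
    by (auto simp: in_set_conv_nth intro!: exI[of _ "d - m"])
qed

lemma set_drop_nth: "x \<in> set (drop m w) \<longleftrightarrow> (\<exists>d. m \<le> d \<and> d < length w \<and> w ! d = x)"
  using set_take_drop_nth[of x "length w" m w] by auto

lemma set_take_nth: "x \<in> set (take n w) \<longleftrightarrow> (\<exists>d. d < n \<and> d < length w \<and> w ! d = x)"
  using set_take_drop_nth[of x n 0 w] by auto

lemma tableauD:
  assumes "is_tableau T"
  shows "j < length T \<Longrightarrow> sorted (T ! j)" "j < length T \<Longrightarrow> T ! j \<noteq> []"
    "j < length T \<Longrightarrow> c < length (T ! j) \<Longrightarrow> 0 < T ! j ! c"
    "Suc j < length T \<Longrightarrow> length (T ! Suc j) \<le> length (T ! j)"
    "Suc j < length T \<Longrightarrow> c < length (T ! Suc j) \<Longrightarrow> T ! j ! c < T ! Suc j ! c"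
  using assms nth_mem[of j T] nth_mem[of c "T ! j"] unfolding is_tableau_def by blast+

text \<open>
  A letter \<open>i\<close> directly below a letter \<open>i + 1\<close> is paired, and so is the \<open>i + 1\<close>. In the
  lower row all letters \<open>i\<close> up to the given column have an \<open>i + 1\<close> above them, by monotonicity of both rows, so
  the upper row alone has enough opening brackets for the lower \<open>i\<close>; likewise all letters \<open>i + 1\<close> of
  the upper row from the given column on have an \<open>i\<close> below them, so the lower row alone has enough
  closing brackets for the upper \<open>i + 1\<close>. This is why changing unpaired letters cannot break the strict
  increase along columns.
\<close>

lemma domino_not_free:
  assumes T: "is_tableau T" and j: "Suc j < length T" and c: "c < length (T ! Suc j)"
    and x: "T ! j ! c = i" and y: "T ! Suc j ! c = Suc i"
  shows "row_start T j + c \<notin> free_positions i (reading T)"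
    and "row_start T (Suc j) + c \<notin> free_positions i (reading T)"
proof -
  define R where "R = T ! j"
  define R' where "R' = T ! Suc j"
  have sR: "sorted R" and sR': "sorted R'" and len: "length R' \<le> length R"
    and less: "\<And>d. d < length R' \<Longrightarrow> R ! d < R' ! d"
    using tableauD[OF T] j by (auto simp: R_def R'_def)
  have cR': "c < length R'" and cR: "c < length R" and Rc: "R ! c = i" and R'c: "R' ! c = Suc i"
    using c x y len by (auto simp: R_def R'_def)
  have dj: "drop (Suc j) T = R' # drop (Suc (Suc j)) T"
    using j by (simp add: R'_def Cons_nth_drop_Suc)
  show "row_start T j + c \<notin> free_positions i (reading T)"
  proof
    assume "row_start T j + c \<in> free_positions i (reading T)"
    then have "left_ok i (take (row_start T j + c) (reading T))"
      using reading_nth[of j T c] j cR Rc by (auto simp: free_positions_def R_def)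
    then have ok: "left_ok i ((reading (drop (Suc (Suc j)) T) @ take a R') @ drop a R' @ take c R)" for a
    proof -
      have "take (row_start T j + c) (reading T) = reading (drop (Suc (Suc j)) T) @ R' @ take c R"
        using take_reading[of j T c] j cR by (simp add: dj reading_Cons R_def)
      also have "\<dots> = (reading (drop (Suc (Suc j)) T) @ take a R') @ drop a R' @ take c R"
        by (metis append.assoc append_take_drop_id)
      finally show ?thesis using \<open>left_ok i (take (row_start T j + c) (reading T))\<close> by simp
    qed
    \<comment> \<open>\<open>a\<close> is the column where the block of letters \<open>i\<close> of the lower row begins.\<close>
    obtain a where a: "a \<le> length R" "\<And>d. d < length R \<Longrightarrow> d < a \<longleftrightarrow> R ! d < i"
      using sorted_threshold[OF sR] by blast
    have ac: "a \<le> c" using a(2)[OF cR] Rc by simp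
    have "\<And>x. x \<in> set (take (Suc c - a) (drop a R')) \<Longrightarrow> x = Suc i"
    proof -
      fix x assume "x \<in> set (take (Suc c - a) (drop a R'))"
      then obtain d where d: "a \<le> d" "d \<le> c" "R' ! d = x"
        using ac by (auto simp: set_take_drop_nth)
      then have "i \<le> R ! d" using a(2)[of d] cR by auto
      moreover have "R ! d < R' ! d" using less[of d] d cR' by simp
      moreover have "R' ! d \<le> Suc i" using sorted_nth_mono[OF sR' d(2) cR'] R'c by simp
      ultimately show "x = Suc i" using d by simp
    qed
    then have "wt i (take (Suc c - a) (drop a R')) = - int (Suc c - a)"
      using wt_const_Suc[of "take (Suc c - a) (drop a R')" i] cR' ac by auto
    moreover have "wt i (drop (Suc c) R') \<le> 0"
    proof (intro wt_nonpos notI)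
      assume "i \<in> set (drop (Suc c) R')"
      then obtain d where "Suc c \<le> d" "d < length R'" "R' ! d = i" by (auto simp: set_drop_nth)
      then show False using sorted_nth_mono[OF sR', of c d] R'c by simp
    qed
    moreover have "drop a R' = take (Suc c - a) (drop a R') @ drop (Suc c) R'"
      using ac by (metis Suc_diff_le append_take_drop_id drop_drop le_Suc_eq le_add_diff_inverse2)
    ultimately have w1: "wt i (drop a R') \<le> - int (Suc c - a)" by (metis add_mono_thms_linordered_semiring(1) add_0_right order_refl wt_simps(2))
    have "wt i (take c R) = wt i (take a R) + wt i (take (c - a) (drop a R))"
      using ac by (metis le_add_diff_inverse take_add wt_simps(2))
    moreover have "wt i (take a R) = 0"
      using a by (intro wt_zero) (force simp: set_take_nth)+
    moreover have "wt i (take (c - a) (drop a R)) \<le> int (c - a)"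
      using wt_le_length[of i "take (c - a) (drop a R)"] by simp
    ultimately have "wt i (drop a R' @ take c R) < 0"
      using w1 ac by simp
    then show False using left_ok_suffix[OF ok[of a]] by simp
  qed
  show "row_start T (Suc j) + c \<notin> free_positions i (reading T)"
  proof
    assume "row_start T (Suc j) + c \<in> free_positions i (reading T)"
    then have free: "right_ok i 0 (drop (row_start T (Suc j) + Suc c) (reading T))"
      using reading_nth[of "Suc j" T c] j c y by (auto simp: free_positions_def)
    have "reading (take (Suc j) T) = R @ reading (take j T)"
      using j by (simp add: take_Suc_conv_app_nth R_def reading_append reading_Cons)
    then have "drop (row_start T (Suc j) + Suc c) (reading T) = drop (Suc c) R' @ R @ reading (take j T)"
      using drop_reading[of "Suc j" T "Suc c"] j c by (simp add: R'_def)
    then have ok: "right_ok i 0 ((drop (Suc c) R' @ take q R) @ drop q R @ reading (take j T))" for q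
      using free by (metis append.assoc append_take_drop_id)
    \<comment> \<open>\<open>q\<close> is the column after the block of letters \<open>i + 1\<close> of the upper row.\<close>
    obtain q where q: "q \<le> length R'" "\<And>d. d < length R' \<Longrightarrow> d < q \<longleftrightarrow> R' ! d < Suc (Suc i)"
      using sorted_threshold[OF sR'] by blast
    have cq: "c < q" using q(2)[OF cR'] R'c by simp
    have "\<And>x. x \<in> set (take (q - c) (drop c R)) \<Longrightarrow> x = i"
    proof -
      fix x assume "x \<in> set (take (q - c) (drop c R))"
      then obtain d where d: "c \<le> d" "d < q" "R ! d = x"
        using cq by (auto simp: set_take_drop_nth)
      have "R' ! d \<le> Suc i" using q(2)[of d] q(1) d by auto
      moreover have "R ! d < R' ! d" using less[of d] d q(1) by simp
      moreover have "i \<le> R ! d" using sorted_nth_mono[OF sR d(1)] d q(1) len Rc by simp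
      ultimately show "x = i" using d by simp
    qed
    then have "wt i (take (q - c) (drop c R)) = int (q - c)"
      using wt_const[of "take (q - c) (drop c R)" i] q(1) len by auto
    moreover have "take q R = take c R @ take (q - c) (drop c R)"
      using cq by (metis le_add_diff_inverse less_imp_le take_add)
    moreover have "0 \<le> wt i (take c R)"
    proof (intro wt_nonneg notI)
      assume "Suc i \<in> set (take c R)"
      then obtain d where "d < c" "R ! d = Suc i" by (auto simp: set_take_nth)
      then show False using sorted_nth_mono[OF sR, of d c] cR Rc by simp
    qed
    ultimately have "int (q - c) \<le> wt i (take q R)" by simp
    moreover have "- int (q - Suc c) \<le> wt i (drop (Suc c) R')"
    proof -
      have "wt i (take (q - Suc c) (drop (Suc c) R')) \<ge> - int (length (take (q - Suc c) (drop (Suc c) R')))"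
        unfolding wt_def using count_le_length[of "take (q - Suc c) (drop (Suc c) R')" "Suc i"] by linarith
      moreover have "wt i (drop q R') = 0"
        using q by (intro wt_zero) (fastforce simp: set_drop_nth)+
      moreover have "drop (Suc c) R' = take (q - Suc c) (drop (Suc c) R') @ drop q R'"
        using cq by (metis Suc_leI append_take_drop_id drop_drop le_add_diff_inverse2)
      ultimately show ?thesis using wt_simps(2)[of i "take (q - Suc c) (drop (Suc c) R')" "drop q R'"]
        by (simp add: min_def split: if_splits)
    qed
    ultimately have "wt i (drop (Suc c) R' @ take q R) > 0"
      using cq by simp
    then show False using right_ok_prefix[OF ok[of q]] by simp
  qed
qed

text \<open>
  Inside a block of equal letters the unpaired letters \<open>i\<close> are the last ones and the unpaired
  letters \<open>i + 1\<close> the first ones. Hence in a row the unpaired letters are contiguous, and rewriting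
  them in nondecreasing order keeps the row nondecreasing.
\<close>

lemma free_right_neighbour:
  assumes "p \<in> free_positions i w" "p \<le> q" "q < length w" "\<And>r. p \<le> r \<Longrightarrow> r \<le> q \<Longrightarrow> w ! r = i"
  shows "q \<in> free_positions i w"
proof -
  have "left_ok i (take p w)" using assms by (auto simp: free_positions_def)
  moreover have "take q w = take p w @ take (q - p) (drop p w)"
    using assms by (metis le_add_diff_inverse take_add)
  moreover have "\<forall>x\<in>set (take (q - p) (drop p w)). x = i"
    using assms(2,4) by (intro ballI) (auto simp: set_take_drop_nth)
  ultimately have "left_ok i (take q w)"
    using left_ok_replicate[of i "take p w" "take (q - p) (drop p w)"] by simp
  then show ?thesis using assms by (auto simp: free_positions_def)
qed

lemma free_left_neighbour:
  assumes "q \<in> free_positions i w" "p \<le> q" "\<And>r. p \<le> r \<Longrightarrow> r \<le> q \<Longrightarrow> w ! r = Suc i"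
  shows "p \<in> free_positions i w"
proof -
  have "right_ok i 0 (drop (Suc q) w)" "q < length w" using assms by (auto simp: free_positions_def)
  moreover have "drop (Suc p) w = take (q - p) (drop (Suc p) w) @ drop (Suc q) w"
    using assms by (metis Suc_le_mono add_Suc_right append_take_drop_id drop_drop le_add_diff_inverse2)
  moreover have "\<forall>x\<in>set (take (q - p) (drop (Suc p) w)). x = Suc i"
    using assms(2,3) by (intro ballI) (auto simp: set_take_drop_nth)
  ultimately have "right_ok i 0 (drop (Suc p) w)"
    using right_ok_replicate[of i 0 "drop (Suc q) w" "take (q - p) (drop (Suc p) w)"] by simp
  then show ?thesis using assms \<open>q < length w\<close> by (auto simp: free_positions_def)
qed

lemma sigma_tableau:
  assumes T: "is_tableau T" and i: "1 \<le> i"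
  shows "is_tableau (sigma i T)"
proof -
  let ?U = "free_positions i (reading T)"
  let ?p = "\<lambda>j c. row_start T j + c"
  let ?T = "sigma i T"
  have l: "map length ?T = map length T" using shape_sigma by (simp add: shape_def)
  then have len: "length ?T = length T" by (metis length_map)
  have lens: "length (?T ! j) = length (T ! j)" if "j < length T" for j
    using l that len by (metis nth_map)
  have fixed: "?T ! j ! c = T ! j ! c"
    if "j < length T" "c < length (T ! j)" "?p j c \<notin> ?U" for j c
    using that by (simp add: sigma_nth sigma_word_properties(2) reading_nth)
  have moved: "(?T ! j ! c = i \<or> ?T ! j ! c = Suc i) \<and> (T ! j ! c = i \<or> T ! j ! c = Suc i)"
    if "j < length T" "c < length (T ! j)" "?p j c \<in> ?U" for j c
    using that sigma_word_properties(3)[OF that(3)] reading_nth(2)[OF that(1,2)]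
    by (auto simp: sigma_nth free_positions_def)
  have rows: "sorted (?T ! j)" if j: "j < length T" for j
  proof -
    have "?T ! j ! c \<le> ?T ! j ! d" if cd: "c < d" "d < length (T ! j)" for c d
    proof -
      have cl: "c < length (T ! j)" using cd by simp
      have le: "T ! j ! r \<le> T ! j ! s" if "r \<le> s" "s < length (T ! j)" for r s
        using tableauD(1)[OF T j] that by (simp add: sorted_nth_mono)
      have between: "\<exists>b. r = ?p j b \<and> c \<le> b \<and> b \<le> d" if "?p j c \<le> r" "r \<le> ?p j d" for r
        using that by (intro exI[of _ "r - row_start T j"]) auto
      consider "?p j c \<notin> ?U" "?p j d \<notin> ?U" | "?p j c \<in> ?U" "?p j d \<in> ?U"
        | "?p j c \<in> ?U" "?p j d \<notin> ?U" | "?p j c \<notin> ?U" "?p j d \<in> ?U" by blast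
      then show ?thesis
      proof cases
        case 1
        then show ?thesis using fixed[OF j cl] fixed[OF j cd(2)] le[of c d] cd by simp
      next
        case 2
        then show ?thesis using sigma_word_properties(4)[OF 2] cd j cl by (simp add: sigma_nth)
      next
        case 3
        have "T ! j ! d \<noteq> i"
        proof
          assume di: "T ! j ! d = i"
          have "T ! j ! c = i" using moved[OF j cl 3(1)] le[of c d] di cd by auto
          then have "T ! j ! b = i" if "c \<le> b" "b \<le> d" for b
            using le[of c b] le[of b d] that di cd by auto
          then have "reading T ! r = i" if "?p j c \<le> r" "r \<le> ?p j d" for r
            using between[OF that] cd j reading_nth(2)[of j T] by auto
          then show False
            using free_right_neighbour[OF 3(1), of "?p j d"] 3(2) reading_nth(1)[OF j cd(2)] cd by auto
        qed
        then show ?thesis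
          using moved[OF j cl 3(1)] fixed[OF j cd(2) 3(2)] le[of c d] cd by auto
      next
        case 4
        have "T ! j ! c \<noteq> Suc i"
        proof
          assume ci: "T ! j ! c = Suc i"
          have "T ! j ! d = Suc i" using moved[OF j cd(2) 4(2)] le[of c d] ci cd by auto
          then have "T ! j ! b = Suc i" if "c \<le> b" "b \<le> d" for b
            using le[of c b] le[of b d] that ci cd by auto
          then have "reading T ! r = Suc i" if "?p j c \<le> r" "r \<le> ?p j d" for r
            using between[OF that] cd j reading_nth(2)[of j T] by auto
          then show False
            using free_left_neighbour[OF 4(2), of "?p j c"] 4(1) cd by auto
        qed
        then show ?thesis
          using moved[OF j cd(2) 4(2)] fixed[OF j cl 4(1)] le[of c d] cd by auto
      qed
    qed
    then show ?thesis using lens[OF j] by (simp add: sorted_iff_nth_mono_less)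
  qed
  have columns: "?T ! j ! c < ?T ! Suc j ! c"
    if j: "Suc j < length T" and c: "c < length (T ! Suc j)" for j c
  proof -
    have j': "j < length T" and c': "c < length (T ! j)" using j c tableauD(4)[OF T j] by auto
    have less: "T ! j ! c < T ! Suc j ! c" using tableauD(5)[OF T j c] .
    have dom: "?p j c \<notin> ?U \<and> ?p (Suc j) c \<notin> ?U" if "T ! j ! c = i" "T ! Suc j ! c = Suc i"
      using domino_not_free[OF T j c that] by simp
    show ?thesis
      using dom less fixed[OF j' c'] fixed[OF j c] moved[OF j' c'] moved[OF j c] by force
  qed
  have pos: "0 < ?T ! j ! c" if "j < length T" "c < length (T ! j)" for j c
    using fixed[OF that] moved[OF that] tableauD(3)[OF T that] i by force
  show ?thesis unfolding is_tableau_def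
  proof (intro conjI ballI allI impI)
    fix r assume "r \<in> set ?T"
    then obtain j where j: "j < length T" "r = ?T ! j" using len by (metis in_set_conv_nth)
    show "r \<noteq> []" using lens[OF j(1)] tableauD(2)[OF T j(1)] j(2) by auto
    show "sorted r" using rows j by simp
    fix x assume "x \<in> set r"
    then show "0 < x" using pos[OF j(1)] lens[OF j(1)] j by (auto simp: in_set_conv_nth)
  next
    fix j assume "Suc j < length ?T"
    then show "length (?T ! Suc j) \<le> length (?T ! j)" using len lens tableauD(4)[OF T] by simp
  next
    fix j c assume "Suc j < length ?T" "c < length (?T ! Suc j)"
    then show "?T ! j ! c < ?T ! Suc j ! c" using columns len lens by simp
  qed
qed

lemma count_reading_sigma:
  "count (mset (reading (sigma i T))) a =
      (if a = i then count (mset (reading T)) (Suc i)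
       else if a = Suc i then count (mset (reading T)) i
       else count (mset (reading T)) a)"
  by (simp add: reading_sigma sigma_word_properties(5))

section \<open>Partitions and dominance\<close>

lemma is_partition_Cons:
  "is_partition (x # l) \<longleftrightarrow> 0 < x \<and> (\<forall>y\<in>set l. y \<le> x) \<and> is_partition l"
  by (auto simp: is_partition_def)

lemma is_partition_append:
  "is_partition (l @ m) \<longleftrightarrow> is_partition l \<and> is_partition m \<and> (\<forall>x\<in>set l. \<forall>y\<in>set m. y \<le> x)"
  by (auto simp: is_partition_def sorted_wrt_append)

lemma is_partition_antimono:
  assumes "is_partition l" "i \<le> j" "j < length l"
  shows "l ! j \<le> l ! i"
  using assms by (cases "i = j") (auto simp: is_partition_def sorted_wrt_iff_nth_less)

lemma part_simps [simp]:
  "part [] i = 0"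
  "part (x # l) 0 = x"
  "part (x # l) (Suc i) = part l i"
  by (auto simp: part_def)

lemma part_append: "part (l @ m) i = (if i < length l then l ! i else part m (i - length l))"
  by (auto simp: part_def nth_append)

lemma partition_eqI:
  assumes "is_partition l" "is_partition m" "\<And>i. part l i = part m i"
  shows "l = m"
proof -
  have "i < length l \<longleftrightarrow> 0 < part l i" "i < length m \<longleftrightarrow> 0 < part m i" for i
    using assms(1,2) by (auto simp: part_def is_partition_def)
  then have "i < length l \<longleftrightarrow> i < length m" for i using assms(3) by simp
  then have "length l = length m" by (metis less_irrefl_nat linorder_neqE_nat)
  then show ?thesis using assms(3) by (intro nth_equalityI) (auto simp: part_def split: if_splits, metis)
qed

lemma sum_list_take_Suc: "sum_list (take (Suc i) l) = sum_list (take i l) + part l i"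
  by (auto simp: part_def take_Suc_conv_app_nth)

lemma dominated_refl: "dominated l l"
  by (simp add: dominated_def)

lemma dominated_trans: "dominated l m \<Longrightarrow> dominated m n \<Longrightarrow> dominated l n"
  unfolding dominated_def by (metis le_trans)

lemma dominated_antisym:
  assumes "is_partition l" "is_partition m" "dominated l m" "dominated m l"
  shows "l = m"
proof (rule partition_eqI[OF assms(1,2)])
  fix i
  have "sum_list (take n l) = sum_list (take n m)" for n
    using assms(3,4) by (simp add: dominated_def eq_iff)
  then show "part l i = part m i"
    using sum_list_take_Suc[of i l] sum_list_take_Suc[of i m] by simp
qed

lemma finite_partitions: "finite {l. is_partition l \<and> sum_list l = n}"
proof (rule finite_subset)
  have "length l \<le> sum_list l" if "is_partition l" for l
    using that by (induction l) (auto simp: is_partition_Cons)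
  then show "{l. is_partition l \<and> sum_list l = n} \<subseteq> {l. set l \<subseteq> {..n} \<and> length l \<le> n}"
    by (auto intro: member_le_sum_list)
  show "finite {l. set l \<subseteq> {..n} \<and> length l \<le> n}"
    by (rule finite_lists_length_le) simp
qed

lemma is_partition_shape:
  assumes "is_tableau T"
  shows "is_partition (shape T)"
proof -
  have "sorted_wrt (\<ge>) (shape T)"
    using tableauD(4)[OF assms]
    by (subst sorted_wrt_iff_nth_Suc_transp) (auto simp: transp_def shape_def)
  then show ?thesis using assms by (auto simp: is_partition_def shape_def is_tableau_def)
qed

section \<open>Tableaux with constant rows\<close>

text \<open>
  For a partition \<open>l\<close> these tableaux, with \<open>m\<close> arbitrary, are the members of \<open>superstandard l\<close>.
\<close>

fun row_tableau :: "nat \<Rightarrow> nat list \<Rightarrow> nat list list" where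
  "row_tableau m [] = []"
| "row_tableau m (x # l) = replicate x (Suc m) # row_tableau (Suc m) l"

lemma shape_row_tableau [simp]: "shape (row_tableau m l) = l"
  by (induction m l rule: row_tableau.induct) (auto simp: shape_def)

lemma length_row_tableau [simp]: "length (row_tableau m l) = length l"
  by (induction m l rule: row_tableau.induct) auto

lemma row_tableau_append: "row_tableau m (l @ l') = row_tableau m l @ row_tableau (m + length l) l'"
  by (induction m l rule: row_tableau.induct) auto

lemma row_tableau_nth: "j < length l \<Longrightarrow> row_tableau m l ! j = replicate (l ! j) (Suc (m + j))"
  by (induction m l arbitrary: j rule: row_tableau.induct) (auto simp: nth_Cons split: nat.splits)

lemma is_tableau_row_tableau:
  assumes "is_partition l"
  shows "is_tableau (row_tableau m l)"
  unfolding is_tableau_def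
proof (intro conjI ballI allI impI)
  fix r assume "r \<in> set (row_tableau m l)"
  then obtain j where j: "j < length l" "r = replicate (l ! j) (Suc (m + j))"
    by (metis in_set_conv_nth length_row_tableau row_tableau_nth)
  then show "r \<noteq> []" using assms by (auto simp: is_partition_def)
  show "sorted r" using j by simp
  show "0 < x" if "x \<in> set r" for x using that j by simp
next
  fix i assume i: "Suc i < length (row_tableau m l)"
  then show *: "length (row_tableau m l ! Suc i) \<le> length (row_tableau m l ! i)"
    using is_partition_antimono[OF assms, of i "Suc i"] by (simp add: row_tableau_nth)
  fix j assume "j < length (row_tableau m l ! Suc i)"
  then show "row_tableau m l ! i ! j < row_tableau m l ! Suc i ! j"
    using i * by (simp add: row_tableau_nth)
qed

lemma count_row_tableau:
  "count (mset (reading (row_tableau m l))) a = (if a \<le> m then 0 else part l (a - Suc m))"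
proof (induction m l rule: row_tableau.induct)
  case (2 m x l)
  show ?case
  proof (cases "a \<le> Suc m")
    case True
    then show ?thesis using 2 by (auto simp: reading_Cons)
  next
    case False
    then obtain b where "a = Suc (Suc (m + b))" by (metis add_Suc less_iff_Suc_add not_le)
    then show ?thesis using 2 by (auto simp: reading_Cons)
  qed
qed simp

lemma set_reading: "set (reading T) = (\<Union>r\<in>set T. set r)"
  by (auto simp: reading_def)

lemma reading_row_tableau_greater: "x \<in> set (reading (row_tableau m l)) \<Longrightarrow> m < x"
  by (induction m l rule: row_tableau.induct) (auto simp: reading_Cons)

lemma entry_in_reading:
  "j < length T \<Longrightarrow> c < length (T ! j) \<Longrightarrow> T ! j ! c \<in> set (reading T)"
  by (auto simp: set_reading intro!: bexI[of _ "T ! j"])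

lemma tableau_entry_ge:
  assumes "is_tableau T" "\<And>x. x \<in> set (reading T) \<Longrightarrow> m < x" "j < length T" "c < length (T ! j)"
  shows "Suc (m + j) \<le> T ! j ! c"
  using assms(3,4)
proof (induction j)
  case 0
  then show ?case using assms(2)[OF entry_in_reading[OF 0]] by simp
next
  case (Suc j)
  then show ?case using tableauD(4,5)[OF assms(1), of j] by fastforce
qed

lemma row_tableau_eqI:
  assumes "\<And>j c. j < length T \<Longrightarrow> c < length (T ! j) \<Longrightarrow> T ! j ! c = Suc (m + j)"
  shows "T = row_tableau m (shape T)"
  by (rule nth_equalityI)
    (auto simp: shape_def row_tableau_nth assms intro!: nth_equalityI)

text \<open>
  The multiset of letters of a word of evaluation \<open>l\<close>. As a multiset it is also the monomial
  \<open>x\<^sup>l\<close> at which coefficients of Schur functions are taken.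
\<close>

definition weight :: "nat list \<Rightarrow> nat multiset" where
  "weight l = mset (reading (row_tableau 0 l))"

lemma size_filter_weight: "size (filter_mset (\<lambda>a. a \<le> n) (weight l)) = sum_list (take n l)"
proof -
  have "row_tableau 0 l = row_tableau 0 (take n l) @ row_tableau (min n (length l)) (drop n l)"
    using row_tableau_append[of 0 "take n l" "drop n l"] by (simp add: min.commute)
  then have w: "weight l = mset (reading (row_tableau 0 (take n l))) + mset (reading (row_tableau (min n (length l)) (drop n l)))"
    by (simp add: weight_def reading_append)
  have f1: "filter_mset (\<lambda>a. a \<le> n) (mset (reading (row_tableau 0 (take n l)))) = mset (reading (row_tableau 0 (take n l)))"
    by (auto simp: filter_mset_eq_conv set_reading in_set_conv_nth row_tableau_nth)
  have f2: "filter_mset (\<lambda>a. a \<le> n) (mset (reading (row_tableau (min n (length l)) (drop n l)))) = {#}"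
  proof (cases "n \<le> length l")
    case True
    then show ?thesis using reading_row_tableau_greater[of _ n "drop n l"] by (fastforce simp: filter_mset_eq_mempty_iff)
  qed simp
  show ?thesis unfolding w filter_union_mset f1 f2 by (simp add: length_reading)
qed

text \<open>
  Columns increase strictly, so the letters up to \<open>n\<close> occur in the first \<open>n\<close> rows only.
\<close>

lemma size_filter_tableau:
  assumes "is_tableau T"
  shows "size (filter_mset (\<lambda>a. a \<le> n) (mset (reading T))) =
    size (filter_mset (\<lambda>a. a \<le> n) (mset (reading (take n T))))"
proof -
  have "n < x" if "x \<in> set (reading (drop n T))" for x
  proof -
    obtain r where "r \<in> set (drop n T)" "x \<in> set r"
      using \<open>x \<in> set (reading (drop n T))\<close> unfolding set_reading by blast
    then obtain j c where "j < length T - n" "c < length (T ! (n + j))" "x = T ! (n + j) ! c"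
      by (auto simp: in_set_conv_nth)
    then show ?thesis
      using tableau_entry_ge[OF assms, of 0 "n + j" c] assms less_diff_conv[of j "length T" n]
      by (fastforce simp: is_tableau_def set_reading)
  qed
  then have "filter_mset (\<lambda>a. a \<le> n) (mset (reading (drop n T))) = {#}"
    by (fastforce simp: filter_mset_eq_mempty_iff)
  moreover have "mset (reading T) = mset (reading (take n T)) + mset (reading (drop n T))"
    by (metis append_take_drop_id mset_append reading_append union_commute)
  ultimately show ?thesis by simp
qed

text \<open>
  The first \<open>i\<close> rows have room for all letters up to \<open>i\<close>. This is the triangularity of the Kostka
  numbers; the next lemma is the statement that they are \<open>1\<close> on the diagonal.
\<close>

lemma dominated_shape:
  assumes "is_tableau T" "mset (reading T) = weight l"
  shows "dominated l (shape T)"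
  unfolding dominated_def
proof (intro conjI allI)
  show "sum_list l = sum_list (shape T)"
    using arg_cong[OF assms(2), of size] by (simp add: weight_def length_reading)
  fix i
  have "sum_list (take i l) = size (filter_mset (\<lambda>a. a \<le> i) (mset (reading (take i T))))"
    using size_filter_weight[of i l] size_filter_tableau[OF assms(1), of i] assms(2) by simp
  also have "\<dots> \<le> length (reading (take i T))"
    using size_filter_mset_lesseq[of _ "mset (reading (take i T))"] by simp
  also have "\<dots> = sum_list (take i (shape T))"
    by (simp add: length_reading) (simp add: shape_def take_map)
  finally show "sum_list (take i l) \<le> sum_list (take i (shape T))" .
qed

text \<open>
  If shape and evaluation agree, the letters up to \<open>j + 1\<close> fill the first \<open>j + 1\<close> rows
  completely, which leaves only the letter \<open>j + 1\<close> for row \<open>j\<close>.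
\<close>

lemma row_tableau_unique:
  assumes "is_tableau T" "mset (reading T) = weight l" "shape T = l"
  shows "T = row_tableau 0 l"
proof -
  have "T ! j ! c = Suc (0 + j)" if jc: "j < length T" "c < length (T ! j)" for j c
  proof -
    have "size (filter_mset (\<lambda>a. a \<le> Suc j) (mset (reading (take (Suc j) T))))
        = sum_list (take (Suc j) l)"
      using size_filter_weight[of "Suc j" l] size_filter_tableau[OF assms(1), of "Suc j"] assms(2)
      by simp
    also have "\<dots> = size (mset (reading (take (Suc j) T)))"
      unfolding assms(3)[symmetric] by (simp add: length_reading) (simp add: shape_def take_map)
    finally have "size (filter_mset (\<lambda>a. \<not> a \<le> Suc j) (mset (reading (take (Suc j) T)))) = 0"
      using multiset_partition[of "mset (reading (take (Suc j) T))" "\<lambda>a. a \<le> Suc j"]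
      by (metis add_cancel_left_right size_union)
    moreover have "T ! j ! c \<in># mset (reading (take (Suc j) T))"
      using jc by (auto simp: set_reading take_Suc_conv_app_nth)
    ultimately have "T ! j ! c \<le> Suc j" by auto
    moreover have "Suc (0 + j) \<le> T ! j ! c"
      using tableau_entry_ge[OF assms(1) _ jc, of 0] assms(1)
      by (fastforce simp: is_tableau_def set_reading)
    ultimately show ?thesis by simp
  qed
  then show ?thesis using row_tableau_eqI[of T 0] assms(3) by simp
qed

section \<open>Knuth equivalence and Yamanouchi words\<close>

text \<open>
  Being a Yamanouchi word is invariant under Knuth equivalence. This gives the uniqueness of
  the tableau in a Knuth class for the classes needed here, by \<open>yamanouchi_tableau\<close> below.
\<close>

lemma knuth_step_left_ok: "knuth_step w w' \<Longrightarrow> left_ok a w \<longleftrightarrow> left_ok a w'"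
proof (induction rule: knuth_step.induct)
  case (1 x y z u v)
  have "left_ok a ([x, z, y] @ v) \<longleftrightarrow> left_ok a ([z, x, y] @ v)"
    using 1 left_ok_wt[of a v] by auto
  then show ?case by (induction u) auto
next
  case (2 x y z u v)
  have "left_ok a ([y, x, z] @ v) \<longleftrightarrow> left_ok a ([y, z, x] @ v)"
    using 2 left_ok_wt[of a v] by auto
  then show ?case by (induction u) auto
qed

lemma knuth_step_mset: "knuth_step w w' \<Longrightarrow> mset w = mset w'"
  by (induction rule: knuth_step.induct) auto

lemma knuth_equiv_invariants:
  assumes "knuth_equiv w w'"
  shows "mset w = mset w'" "left_ok a w \<longleftrightarrow> left_ok a w'"
proof -
  have "mset w = mset w' \<and> (left_ok a w \<longleftrightarrow> left_ok a w')"
    using assms unfolding knuth_equiv_def equivclp_def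
    by (induction rule: rtranclp_induct)
       (auto simp: symclp_def dest: knuth_step_mset knuth_step_left_ok)
  then show "mset w = mset w'" "left_ok a w \<longleftrightarrow> left_ok a w'" by auto
qed

text \<open>
  The counts only decrease as a suffix grows into \<open>u\<close>, so the whole word is the worst case.
\<close>

lemma left_ok_append:
  assumes "a \<notin> set u" "left_ok a v" "0 \<le> wt a (u @ v)"
  shows "left_ok a (u @ v)"
  using assms by (induction u) (auto split: if_splits)

lemma left_ok_reading_row_tableau:
  assumes "is_partition l" "m < a"
  shows "left_ok a (reading (row_tableau m l))"
  using assms
proof (induction l arbitrary: m)
  case (Cons x l)
  show ?case
  proof (cases "a = Suc m")
    case True
    have "a \<notin> set (reading (row_tableau (Suc m) l))" using True reading_row_tableau_greater[of a "Suc m" l] by auto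
    moreover have "left_ok a (replicate x a)" using left_ok_replicate[of a "[]"] by simp
    moreover have "0 \<le> wt a (reading (row_tableau (Suc m) l) @ replicate x a)"
      using Cons.prems True by (cases l) (auto simp: wt_def count_row_tableau is_partition_Cons simp flip: count_mset simp del: row_tableau.simps)
    ultimately show ?thesis using True left_ok_append by (simp add: reading_Cons)
  next
    case False
    then have "left_ok a (reading (row_tableau (Suc m) l))" using Cons by (auto simp: is_partition_Cons)
    have "left_ok a (u @ replicate x (Suc m)) \<longleftrightarrow> left_ok a u" for u
    proof -
      have z: "wt a (replicate y (Suc m)) = 0" for y using False Cons.prems by (intro wt_zero) auto
      have "left_ok a (replicate y (Suc m))" for y
        using z False Cons.prems(2) by (induction y) auto
      then show ?thesis using z by (induction u) auto
    qed
    then show ?thesis using \<open>left_ok a (reading (row_tableau (Suc m) l))\<close> by (simp add: reading_Cons)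
  qed
qed simp

text \<open>
  By induction on the rows from the bottom. The last letter \<open>z\<close> of row \<open>j\<close> is read before the lower
  rows, all of whose letters are at most \<open>m + j\<close>; if \<open>z\<close> exceeded \<open>m + j + 1\<close>, the suffix that begins with it
  would contain the letter \<open>z\<close> but no \<open>z - 1\<close>. So row \<open>j\<close> lies between its minimum \<open>m + j + 1\<close> and its last letter \<open>m + j + 1\<close>.
\<close>

lemma yamanouchi_tableau:
  assumes T: "is_tableau T" and gr: "\<And>x. x \<in> set (reading T) \<Longrightarrow> m < x"
    and ok: "\<And>a. m < a \<Longrightarrow> left_ok a (reading T)"
  shows "T = row_tableau m (shape T)"
proof (rule row_tableau_eqI)
  show "T ! j ! c = Suc (m + j)" if "j < length T" "c < length (T ! j)" for j c
    using that
  proof (induction j arbitrary: c rule: less_induct)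
    case (less j)
    note jl = less.prems(1)
    define z where "z = last (T ! j)"
    have ne: "T ! j \<noteq> []" using tableauD(2)[OF T jl] .
    have zl: "z = T ! j ! (length (T ! j) - 1)" using ne by (simp add: z_def last_conv_nth)
    have lz: "Suc (m + j) \<le> z"
      using tableau_entry_ge[OF T gr jl, of "length (T ! j) - 1"] ne zl by simp
    have below: "x < Suc (m + j)" if "x \<in> set (reading (take j T))" for x
    proof -
      obtain i c where "i < j" "i < length T" "c < length (T ! i)" "x = T ! i ! c"
        using \<open>x \<in> set (reading (take j T))\<close> by (auto simp: set_reading in_set_conv_nth)
      then show ?thesis using less.IH[of i c] by simp
    qed
    have "z \<le> Suc (m + j)"
    proof (rule ccontr)
      assume "\<not> z \<le> Suc (m + j)"
      then obtain a where a: "z = Suc a" "Suc (m + j) \<le> a" by (cases z) auto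
      have "reading T = (reading (drop (Suc j) T) @ butlast (T ! j)) @ [z] @ reading (take j T)"
        using reading_split[OF jl] append_butlast_last_id[OF ne] unfolding z_def
        by (metis append.assoc)
      moreover have "left_ok a (reading T)" using ok[of a] a by simp
      ultimately have "0 \<le> wt a ([z] @ reading (take j T))"
        using left_ok_suffix by metis
      moreover have "wt a (reading (take j T)) = 0"
        using below a by (intro wt_zero) fastforce+
      ultimately show False using a by simp
    qed
    moreover have "T ! j ! c \<le> z"
      using sorted_nth_mono[OF tableauD(1)[OF T jl], of c "length (T ! j) - 1"] less.prems zl by auto
    moreover have "Suc (m + j) \<le> T ! j ! c" using tableau_entry_ge[OF T gr less.prems] .
    ultimately show ?case by simp
  qed
qed

lemma tableau_of_word_row_tableau:
  assumes "is_partition l"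
  shows "tableau_of_word (reading (row_tableau m l)) = row_tableau m l"
  unfolding tableau_of_word_def
proof (rule the_equality)
  show "is_tableau (row_tableau m l) \<and> knuth_equiv (reading (row_tableau m l)) (reading (row_tableau m l))"
    using is_tableau_row_tableau[OF assms] by (simp add: knuth_equiv_def)
next
  fix T assume "is_tableau T \<and> knuth_equiv (reading T) (reading (row_tableau m l))"
  then have T: "is_tableau T" and eq: "knuth_equiv (reading T) (reading (row_tableau m l))" by auto
  note inv = knuth_equiv_invariants[OF eq]
  have "T = row_tableau m (shape T)"
  proof (rule yamanouchi_tableau[OF T])
    show "m < x" if "x \<in> set (reading T)" for x
      using that reading_row_tableau_greater mset_eq_setD[OF inv(1)] by blast
    show "left_ok a (reading T)" if "m < a" for a
      using inv(2) left_ok_reading_row_tableau[OF assms that] by blast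
  qed
  moreover have "shape T = l"
  proof (rule partition_eqI[OF is_partition_shape[OF T] assms])
    fix i
    have "count (mset (reading (row_tableau m (shape T)))) (Suc (m + i)) = count (mset (reading (row_tableau m l))) (Suc (m + i))"
      using inv(1) \<open>T = row_tableau m (shape T)\<close> by metis
    then show "part (shape T) i = part l i" by (simp add: count_row_tableau)
  qed
  ultimately show "T = row_tableau m l" by simp
qed

section \<open>The split of a partition and katabolism\<close>

lemma is_k_split_Nil: "is_k_split k [] S \<longleftrightarrow> S = []"
  by (cases S) (auto simp: is_k_split_def)

lemma is_k_split_single: "is_k_split k l [m] \<longleftrightarrow> m = l \<and> l \<noteq> [] \<and> main_hook l \<le> k"
  by (auto simp: is_k_split_def)

lemma is_k_split_Cons:
  assumes "S \<noteq> []"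
  shows "is_k_split k l (m # S) \<longleftrightarrow>
    (\<exists>l'. l = m @ l' \<and> m \<noteq> [] \<and> main_hook m = k \<and> is_k_split k l' S)"
  using assms by (auto simp: is_k_split_def)

text \<open>
  A block that starts with the part \<open>x\<close> and has main hook-length \<open>k\<close> must have length \<open>k + 1 - x\<close>,
  so every cut is forced.
\<close>

lemma ex1_k_split:
  assumes "\<forall>x\<in>set l. x \<le> k"
  shows "\<exists>!S. is_k_split k l S"
  using assms
proof (induction l rule: length_induct)
  case (1 l)
  show ?case
  proof (cases l)
    case Nil
    then show ?thesis by (simp add: is_k_split_Nil)
  next
    case (Cons x l')
    define n where "n = Suc k - x"
    have n: "0 < n" and xk: "x \<le> k" using 1 Cons by (auto simp: n_def)
    have hook: "main_hook (x # m) = k \<longleftrightarrow> length (x # m) = n"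
      "main_hook (x # m) \<le> k \<longleftrightarrow> length (x # m) \<le> n" for m
      using xk by (auto simp: main_hook_def n_def)
    show ?thesis
    proof (cases "length l \<le> n")
      case True
      have "S = [l]" if S: "is_k_split k l S" for S
      proof (cases S)
        case Nil
        then show ?thesis using S Cons by (simp add: is_k_split_def)
      next
        case S_Cons: (Cons m S')
        show ?thesis
        proof (cases "S' = []")
          case False
          then obtain l'' where l'': "l = m @ l''" "m \<noteq> []" "main_hook m = k" "is_k_split k l'' S'"
            using S S_Cons is_k_split_Cons by blast
          then obtain m' where "m = x # m'" using Cons by (cases m) auto
          then have "l'' = []" using l'' hook(1) True by auto
          then show ?thesis using l'' False is_k_split_Nil by blast
        qed (use S S_Cons is_k_split_single in auto)
      qed
      moreover have "is_k_split k l [l]" using True Cons hook(2) by (simp add: is_k_split_single)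
      ultimately show ?thesis by blast
    next
      case False
      then have "length (drop n l) < length l" using n Cons by auto
      moreover have "\<forall>x\<in>set (drop n l). x \<le> k" using 1 by (meson in_set_dropD)
      ultimately obtain S0 where S0: "is_k_split k (drop n l) S0"
        and S0u: "\<And>S. is_k_split k (drop n l) S \<Longrightarrow> S = S0" using 1 by blast
      have ne: "S0 \<noteq> []" using S0 False by (auto simp: is_k_split_def)
      have tk: "take n l = x # take (n - 1) l'" using n Cons by (cases n) auto
      have "main_hook (take n l) = k" using tk hook(1)[of "take (n - 1) l'"] False n Cons by auto
      moreover have "take n l \<noteq> []" using tk by simp
      ultimately have "is_k_split k l (take n l # S0)"
        unfolding is_k_split_Cons[OF ne] using S0 by (metis append_take_drop_id)
      moreover have "S = take n l # S0" if S: "is_k_split k l S" for S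
      proof (cases S)
        case Nil
        then show ?thesis using S Cons by (simp add: is_k_split_def)
      next
        case S_Cons: (Cons m S')
        show ?thesis
        proof (cases "S' = []")
          case True
          then show ?thesis using S S_Cons Cons hook(2) False by (auto simp: is_k_split_single)
        next
          case S': False
          then obtain l'' where l'': "l = m @ l''" "m \<noteq> []" "main_hook m = k" "is_k_split k l'' S'"
            using S S_Cons is_k_split_Cons by blast
          then obtain m' where "m = x # m'" using Cons by (cases m) auto
          then have "length m = n" using l'' hook(1) by auto
          then show ?thesis using l'' S0u S_Cons by auto
        qed
      qed
      ultimately show ?thesis by blast
    qed
  qed
qed

lemma k_split:
  assumes "\<forall>x\<in>set l. x \<le> k"
  shows "concat (k_split k l) = l" "\<forall>m\<in>set (k_split k l). m \<noteq> []"
proof -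
  have "is_k_split k l (k_split k l)"
    unfolding k_split_def by (rule theI'[OF ex1_k_split[OF assms]])
  then show "concat (k_split k l) = l" "\<forall>m\<in>set (k_split k l). m \<noteq> []"
    by (simp_all add: is_k_split_def)
qed

lemma evaluation_row_tableau:
  assumes "is_partition l" "l \<noteq> []"
  shows "evaluation (reading (row_tableau m l)) = replicate m 0 @ l"
proof -
  let ?w = "reading (row_tableau m l)"
  have cnt: "count_list ?w a = (if a \<le> m then 0 else part l (a - Suc m))" for a
    by (metis count_row_tableau count_mset)
  have "Max (insert 0 (set ?w)) = m + length l"
  proof (rule Max_eqI)
    show "y \<le> m + length l" if "y \<in> insert 0 (set ?w)" for y
      using that cnt[of y] count_list_0_iff[of ?w y] by (auto simp: part_def split: if_splits)
    have "0 < part l (length l - 1)" using assms by (auto simp: part_def is_partition_def)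
    then have "count_list ?w (m + length l) > 0" using assms(2) cnt[of "m + length l"]
      by (cases l) auto
    then show "m + length l \<in> insert 0 (set ?w)" using count_list_0_iff[of ?w] by force
  qed simp
  then have "evaluation ?w = map (count_list ?w) [1..<Suc (m + length l)]"
    by (simp add: evaluation_def max_letter_def)
  also have "\<dots> = replicate m 0 @ l"
    by (rule nth_equalityI) (auto simp del: upt_Suc simp: cnt nth_append part_def)
  finally show ?thesis .
qed

lemma evaluation_row_tableau_0: "is_partition l \<Longrightarrow> evaluation (reading (row_tableau 0 l)) = l"
  by (cases "l = []") (use evaluation_row_tableau[of l 0] in \<open>auto simp: evaluation_def max_letter_def\<close>)

lemma take_row_tableau: "map2 take l (row_tableau m (l @ l')) = row_tableau m l"
  by (induction l arbitrary: m) auto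

lemma drop_row_tableau: "reading (map2 drop l (row_tableau m (l @ l'))) = []"
  by (induction l arbitrary: m) (auto simp: reading_Cons)

text \<open>
  Katabolism by the bottom block of a tableau with constant rows just removes that block: nothing
  is left to its right, and the rows above it are already a tableau.
\<close>

lemma katabolism_row_tableau:
  assumes "is_partition (l @ l')" "l \<noteq> []"
  shows "katabolism l (row_tableau m (l @ l')) = {#row_tableau (m + length l) l'#}"
proof -
  have p: "is_partition l" "is_partition l'" using assms by (auto simp: is_partition_append)
  have "contained l (l @ l')" by (auto simp: contained_def part_append part_def nth_append)
  moreover have "row_tableau m l \<in> superstandard l"
    using p(1) assms(2) is_tableau_row_tableau evaluation_row_tableau by (auto simp: superstandard_def)
  ultimately show ?thesis using tableau_of_word_row_tableau[OF p(2)]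
    by (simp add: katabolism_def take_row_tableau drop_row_tableau) (simp add: row_tableau_append)
qed

lemma extend_single [simp]: "extend f {#T#} = f T"
  by (simp add: extend_def)

lemma filtering_row_tableau:
  assumes "is_partition (concat S)" "\<forall>l\<in>set S. l \<noteq> []"
  shows "filtering S (row_tableau m (concat S)) = {#row_tableau m (concat S)#}"
proof -
  have "fold (extend \<circ> katabolism) S {#row_tableau m (concat S)#} = {#[]#}"
    using assms
  proof (induction S arbitrary: m)
    case (Cons l S)
    then show ?case using katabolism_row_tableau[of l "concat S" m] by (auto simp: is_partition_append)
  qed simp
  then show ?thesis by (simp add: filtering_def)
qed

section \<open>Promotion\<close>

lemma max_letter_row_tableau: "is_partition l \<Longrightarrow> max_letter (reading (row_tableau 0 l)) = length l"
  using arg_cong[OF evaluation_row_tableau_0, of l length] by (simp add: evaluation_def del: upt_Suc)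

lemma count_weight: "count (weight l) a = (case a of 0 \<Rightarrow> 0 | Suc i \<Rightarrow> part l i)"
  by (simp add: weight_def count_row_tableau split: nat.split)

lemma max_letter_weight:
  assumes "is_partition l" "mset w = weight l"
  shows "max_letter w = length l"
proof -
  have "set w = set (reading (row_tableau 0 l))"
    using assms(2) unfolding weight_def by (rule mset_eq_setD)
  then show ?thesis using max_letter_row_tableau[OF assms(1)] by (simp add: max_letter_def)
qed

lemma foldr_sigma_tableau:
  assumes "is_tableau T" "\<forall>i\<in>set js. 1 \<le> i"
  shows "is_tableau (foldr sigma js T) \<and> shape (foldr sigma js T) = shape T"
  using assms(2) by (induction js) (auto simp: assms(1) shape_sigma sigma_tableau)

text \<open>
  The composite of the adjacent transpositions acts on evaluations as the cycle that
  moves the last entry to the front.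
\<close>

lemma foldr_sigma_count:
  assumes "a \<le> b"
  shows "count (mset (reading (foldr sigma [a..<b] T))) x =
    (if x = a then count (mset (reading T)) b
     else if a < x \<and> x \<le> b then count (mset (reading T)) (x - 1)
     else count (mset (reading T)) x)"
  using assms
proof (induction a arbitrary: x rule: inc_induct)
  case (step n)
  then have "foldr sigma [n..<b] T = sigma n (foldr sigma [Suc n..<b] T)"
    by (simp add: upt_conv_Cons)
  then show ?case using step by (auto simp: count_reading_sigma)
qed simp

lemma mset_reading: "mset (reading T) = (\<Sum>i<length T. mset (T ! i))"
proof -
  have "mset (reading T) = sum_list (map mset T)"
    by (induction T) (auto simp: reading_Cons add.commute)
  then show ?thesis by (simp add: sum_list_sum_nth atLeast0LessThan)
qed

lemma add_strip_mset:
  assumes T: "is_tableau T" and T': "T' \<in> add_strip r T"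
  shows "mset (reading T') = mset (reading T) + replicate_mset r (Suc (max_letter (reading T)))"
proof -
  define z where "z = Suc (max_letter (reading T))"
  define d where "d i = part (shape T') i - part (shape T) i" for i
  have strip: "horizontal_strip (shape T') (shape T) r"
    and rows: "\<And>i. i < length T' \<Longrightarrow>
      T' ! i = (if i < length T then T ! i else []) @ replicate (d i) z"
    using T' by (auto simp: add_strip_def z_def d_def)
  have len: "length T \<le> length T'"
  proof (rule ccontr)
    assume "\<not> length T \<le> length T'"
    have "part (shape T) (length T') \<le> part (shape T') (length T')"
      using strip by (simp add: horizontal_strip_def contained_def)
    then show False using \<open>\<not> length T \<le> length T'\<close> tableauD(2)[OF T, of "length T'"]
      by (simp add: part_def shape_def)
  qed
  have "mset (reading T') = (\<Sum>i<length T'. mset (T' ! i))" by (rule mset_reading)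
  also have "\<dots> = (\<Sum>i<length T'. (if i < length T then mset (T ! i) else {#}) + replicate_mset (d i) z)"
    by (intro sum.cong) (auto simp: rows)
  also have "\<dots> = (\<Sum>i<length T'. if i < length T then mset (T ! i) else {#}) +
      (\<Sum>i<length T'. replicate_mset (d i) z)" by (rule sum.distrib)
  also have "(\<Sum>i<length T'. if i < length T then mset (T ! i) else {#}) = mset (reading T)"
    unfolding mset_reading using len by (intro sum.mono_neutral_cong_right) auto
  also have "(\<Sum>i<length T'. replicate_mset (d i) z) = replicate_mset (\<Sum>i<length T'. d i) z"
    by (rule multiset_eqI) (simp add: count_sum)
  finally have m: "mset (reading T') = mset (reading T) + replicate_mset (\<Sum>i<length T'. d i) z" .
  have "(\<Sum>i<length T'. d i) = r"
    using arg_cong[OF m, of size] strip by (simp add: length_reading horizontal_strip_def)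
  then show ?thesis using m by (simp add: z_def)
qed

text \<open>
  The strip of \<open>r\<close> new letters makes the evaluation \<open>(l, r)\<close>, and the cycle turns this into \<open>(r, l)\<close>.
\<close>

lemma promotion_content:
  assumes l: "is_partition l" and T: "is_tableau T" "mset (reading T) = weight l"
    and U: "U \<in># promotion r T"
  obtains T' where "T' \<in> add_strip r T" "U = foldr sigma [1..<Suc (length l)] T'"
    "is_tableau U" "shape U = shape T'" "mset (reading U) = weight (r # l)"
proof -
  have m: "max_letter (reading T) = length l" using max_letter_weight[OF l T(2)] .
  have "finite (add_strip r T)"
    using U by (cases "finite (add_strip r T)") (auto simp: promotion_def)
  then obtain T' where T': "T' \<in> add_strip r T" "U = foldr sigma [1..<Suc (length l)] T'"
    using U by (auto simp: promotion_def m simp del: upt_Suc)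
  have "is_tableau T'" using T'(1) by (simp add: add_strip_def)
  then have "is_tableau U" "shape U = shape T'"
    using foldr_sigma_tableau[of T' "[1..<Suc (length l)]"] T'(2) by (auto simp del: upt_Suc)
  moreover have "mset (reading U) = weight (r # l)"
  proof (rule multiset_eqI)
    fix a
    have "mset (reading T') = weight l + replicate_mset r (Suc (length l))"
      using add_strip_mset[OF T(1) T'(1)] T(2) m by simp
    then have c: "count (mset (reading T')) x =
        (if x = Suc (length l) then r else case x of 0 \<Rightarrow> 0 | Suc i \<Rightarrow> part l i)" for x
      by (auto simp: count_weight part_def split: nat.split)
    show "count (mset (reading U)) a = count (weight (r # l)) a"
      unfolding T'(2) by (subst foldr_sigma_count) (auto simp: c count_weight part_def split: nat.split)
  qed
  ultimately show ?thesis using that T' by blast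
qed

lemma extend_add_mset: "extend f (add_mset T A) = f T + extend f A"
  by (simp add: extend_def)

lemma in_extend: "U \<in># extend f A \<longleftrightarrow> (\<exists>T\<in>#A. U \<in># f T)"
  by (induction A) (auto simp: extend_add_mset extend_def)

text \<open>
  Filtering only discards tableaux, so evaluations are governed by promotion alone.
\<close>

lemma super_atom_content:
  assumes "is_partition l" "T \<in># super_atom k l"
  shows "is_tableau T \<and> mset (reading T) = weight l"
  using assms
proof (induction l arbitrary: T)
  case Nil
  then show ?case by (simp add: is_tableau_def weight_def)
next
  case (Cons r l)
  have l: "is_partition l" using Cons.prems(1) by (simp add: is_partition_Cons)
  obtain U where "U \<in># super_atom k l" "T \<in># promotion r U"
    using Cons.prems(2) by (auto simp: in_extend filtering_def split: if_splits)
  then show ?case using Cons.IH[OF l] promotion_content[OF l, of U T r] by blast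
qed

text \<open>
  Unlike \<open>dominated_antisym\<close>, this compares single parts, as the interlacing condition of a horizontal
  strip does.
\<close>

lemma contained_eq:
  assumes "is_partition l" "is_partition m" "\<And>i. part l i \<le> part m i" "sum_list l = sum_list m"
  shows "l = m"
proof (rule partition_eqI[OF assms(1,2)])
  fix i
  define N where "N = length l + length m + Suc i"
  have s: "sum_list xs = (\<Sum>i<N. part xs i)" if "length xs \<le> N" for xs
    using that unfolding sum_list_sum_nth part_def atLeast0LessThan
    by (intro sum.mono_neutral_cong_left) auto
  have "(\<Sum>i<N. part l i) = (\<Sum>i<N. part m i)"
    using assms(4) s[of l] s[of m] by (simp add: N_def)
  then show "part l i = part m i"
    by (rule sum_mono_inv) (use assms(3) in \<open>auto simp: N_def\<close>)
qed

text \<open>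
  A tableau of shape \<open>(r, l)\<close> has \<open>r\<close> columns, and a horizontal \<open>r\<close>-strip with at most one cell per
  column must take the top cell of each of them. What remains has shape \<open>l\<close>, and evaluation \<open>l\<close>, so it
  is the tableau with constant rows.
\<close>

lemma promotion_to_row_tableau:
  assumes l: "is_partition l" and T: "is_tableau T" "mset (reading T) = weight l"
    and U: "row_tableau 0 (r # l) \<in># promotion r T"
  shows "T = row_tableau 0 l"
proof -
  obtain T' where T': "T' \<in> add_strip r T" "shape (row_tableau 0 (r # l)) = shape T'"
    using promotion_content[OF l T U] .
  then have strip: "horizontal_strip (r # l) (shape T) r" by (simp add: add_strip_def del: row_tableau.simps)
  have "part l i \<le> part (shape T) i" for i
    using strip by (auto simp: horizontal_strip_def dest!: spec[of _ i])
  moreover have "sum_list l = sum_list (shape T)"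
    using strip by (simp add: horizontal_strip_def)
  ultimately have "l = shape T" using contained_eq[OF l is_partition_shape[OF T(1)]] by blast
  then show ?thesis using row_tableau_unique[OF T] by simp
qed

lemma add_strip_eqI:
  assumes "T' \<in> add_strip r T" "T'' \<in> add_strip r T" "shape T' = shape T''"
  shows "T' = T''"
proof (rule nth_equalityI)
  show "length T' = length T''" using assms(3) by (metis length_map shape_def)
  then show "T' ! i = T'' ! i" if "i < length T'" for i
    using that assms by (auto simp: add_strip_def)
qed

lemma finite_add_strip: "finite (add_strip r T)"
proof (rule finite_imageD)
  have "shape ` add_strip r T \<subseteq> {l. is_partition l \<and> sum_list l = sum_list (shape T) + r}"
    by (auto simp: add_strip_def horizontal_strip_def intro: is_partition_shape)
  then show "finite (shape ` add_strip r T)" using finite_partitions finite_subset by blast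
  show "inj_on shape (add_strip r T)" using add_strip_eqI by (auto intro: inj_onI)
qed

text \<open>
  Conversely, the top cells of the columns of \<open>(r, l)\<close> form a horizontal strip over \<open>l\<close>.
\<close>

lemma strip_on_row_tableau:
  assumes rl: "is_partition (r # l)"
  obtains T' where "T' \<in> add_strip r (row_tableau 0 l)" "shape T' = r # l"
proof -
  define m where "m = length l"
  have l: "is_partition l" using rl by (simp add: is_partition_Cons)
  define row where "row i = (if i < m then replicate (l ! i) (Suc i) else []) @
    replicate (part (r # l) i - part l i) (Suc m)" for i
  define T' where "T' = map row [0..<Suc m]"
  have dec: "part l i \<le> part (r # l) i" for i
  proof (cases i)
    case 0
    then show ?thesis using rl by (cases l) (auto simp: is_partition_Cons)
  next
    case (Suc j)
    then show ?thesis using is_partition_antimono[OF l, of j i] by (auto simp: part_def)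
  qed
  have len: "length T' = Suc m" by (simp add: T'_def)
  have nth: "T' ! i = row i" if "i < Suc m" for i using that by (simp add: T'_def del: upt_Suc)
  have lrow: "length (row i) = part (r # l) i" for i
    using dec[of i] by (auto simp: row_def part_def m_def)
  have shape: "shape T' = r # l"
    by (rule nth_equalityI)
      (auto simp: shape_def len nth lrow m_def part_def simp del: upt_Suc)
  have entry: "row i ! j = (if j < part l i then Suc i else Suc m)" if "j < length (row i)" for i j
    using that by (auto simp: row_def nth_append m_def part_def)
  have "is_tableau T'"
    unfolding is_tableau_def
  proof (intro conjI ballI allI impI)
    fix w assume "w \<in> set T'"
    then obtain i where i: "i < Suc m" "w = row i" by (auto simp: T'_def simp del: upt_Suc)
    have "(r # l) ! i \<in> set (r # l)" using i by (intro nth_mem) (simp add: m_def)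
    then have "0 < part (r # l) i" using rl i by (auto simp: is_partition_def part_def m_def)
    then show "w \<noteq> []" using lrow[of i] i by auto
    show "sorted w" using i by (auto simp: row_def sorted_append)
    show "0 < x" if "x \<in> set w" for x using that i by (auto simp: row_def split: if_splits)
  next
    fix i assume i: "Suc i < length T'"
    then show *: "length (T' ! Suc i) \<le> length (T' ! i)"
      using is_partition_antimono[OF rl, of i "Suc i"] by (simp add: nth lrow len part_def m_def)
    fix j assume "j < length (T' ! Suc i)"
    then show "T' ! i ! j < T' ! Suc i ! j"
      using i * by (auto simp: nth entry len lrow)
  qed
  moreover have "horizontal_strip (r # l) l r"
    using dec by (auto simp: horizontal_strip_def contained_def)
  moreover have "T' ! i = (if i < length (row_tableau 0 l) then row_tableau 0 l ! i else []) @
      replicate (part (shape T') i - part (shape (row_tableau 0 l)) i) (Suc (max_letter (reading (row_tableau 0 l))))"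
    if "i < length T'" for i
    using that by (simp add: nth len row_def shape row_tableau_nth max_letter_row_tableau[OF l] m_def)
  ultimately have "T' \<in> add_strip r (row_tableau 0 l)"
    unfolding add_strip_def by (simp add: shape)
  then show ?thesis using that shape by blast
qed

text \<open>
  After the action, shape and evaluation are both \<open>(r, l)\<close>, so the result is the tableau with constant
  rows whatever the strip of shape \<open>(r, l)\<close> was; but a strip is determined by the shape it produces.
\<close>

lemma count_promotion_row_tableau:
  assumes rl: "is_partition (r # l)"
  shows "count (promotion r (row_tableau 0 l)) (row_tableau 0 (r # l)) = 1"
proof -
  let ?F = "foldr sigma [1..<Suc (length l)]"
  let ?B = "add_strip r (row_tableau 0 l)"
  have l: "is_partition l" using rl by (simp add: is_partition_Cons)
  have prom: "promotion r (row_tableau 0 l) = image_mset ?F (mset_set ?B)"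
    by (simp add: promotion_def max_letter_row_tableau[OF l])
  have w: "mset (reading (row_tableau 0 l)) = weight l" by (simp add: weight_def)
  obtain S where S: "S \<in> ?B" "shape S = r # l" using strip_on_row_tableau[OF rl] .
  have F: "is_tableau (?F T') \<and> shape (?F T') = shape T' \<and> mset (reading (?F T')) = weight (r # l)"
    if "T' \<in> ?B" for T'
  proof -
    have "?F T' \<in># promotion r (row_tableau 0 l)"
      unfolding prom using that finite_add_strip[of r "row_tableau 0 l"] by simp
    moreover have "is_tableau T'" using that by (simp add: add_strip_def)
    ultimately show ?thesis
      using promotion_content[OF l is_tableau_row_tableau[OF l] w]
        foldr_sigma_tableau[of T' "[1..<Suc (length l)]"]
      by (metis One_nat_def atLeastLessThan_iff set_upt)
  qed
  have "?F -` {row_tableau 0 (r # l)} \<inter> ?B = {S}"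
  proof (intro equalityI subsetI)
    fix T' assume "T' \<in> ?F -` {row_tableau 0 (r # l)} \<inter> ?B"
    then have "T' \<in> ?B" "shape T' = r # l"
      using F[of T'] shape_row_tableau[of 0 "r # l"] by auto
    then show "T' \<in> {S}" using add_strip_eqI S by auto
  next
    fix T' assume "T' \<in> {S}"
    then show "T' \<in> ?F -` {row_tableau 0 (r # l)} \<inter> ?B"
      using F[OF S(1)] S row_tableau_unique[of "?F S" "r # l"] by simp
  qed
  then show ?thesis
    unfolding prom count_image_mset using finite_add_strip[of r "row_tableau 0 l"] S(1) by simp
qed

lemma count_extend_filtering:
  assumes "filtering S T = {#T#}"
  shows "count (extend (filtering S) A) T = count A T"
proof (induction A)
  case (add U A)
  have "count (filtering S U) T = (if U = T then 1 else 0)"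
    using assms by (auto simp: filtering_def)
  then show ?case using add by (simp add: extend_add_mset)
qed (simp add: extend_def)

text \<open>
  By induction on the parts: the tableau with constant rows passes the filter, since each
  katabolism removes one block of the split, and among the tableaux that are promoted only the one
  with constant rows can produce it, in exactly one way.
\<close>

lemma count_super_atom_row_tableau:
  assumes "k_bounded k l"
  shows "count (super_atom k l) (row_tableau 0 l) = 1"
  using assms
proof (induction l)
  case (Cons r l)
  have rl: "is_partition (r # l)" and bd: "\<forall>x\<in>set (r # l). x \<le> k"
    using Cons.prems by (auto simp: k_bounded_def)
  have l: "is_partition l" using rl by (simp add: is_partition_Cons)
  let ?t = "row_tableau 0 (r # l)"
  let ?A = "super_atom k l"
  have "filtering (k_split k (r # l)) ?t = {#?t#}"
    using filtering_row_tableau[of "k_split k (r # l)" 0] k_split[OF bd] rl by metis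
  then have "count (super_atom k (r # l)) ?t = count (extend (promotion r) ?A) ?t"
    by (simp add: count_extend_filtering del: row_tableau.simps)
  also have "\<dots> = 1"
  proof -
    have one: "count ?A (row_tableau 0 l) = 1"
      using Cons by (auto simp: k_bounded_def is_partition_Cons)
    define A where "A = ?A - {#row_tableau 0 l#}"
    have "row_tableau 0 l \<in># ?A" using one by (simp flip: count_greater_zero_iff)
    then have A: "?A = add_mset (row_tableau 0 l) A" "row_tableau 0 l \<notin># A"
      using one by (simp_all add: A_def not_in_iff)
    have "?t \<notin># extend (promotion r) A"
    proof
      assume "?t \<in># extend (promotion r) A"
      then obtain T where T: "T \<in># A" "?t \<in># promotion r T" by (auto simp only: in_extend)
      then have "T \<in># ?A" using A(1) by simp
      then have "T = row_tableau 0 l"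
        using super_atom_content[OF l] promotion_to_row_tableau[OF l] T(2) by blast
      then show False using T(1) A(2) by simp
    qed
    then show ?thesis
      unfolding A(1) extend_add_mset using count_promotion_row_tableau[OF rl]
      by (simp add: not_in_iff del: row_tableau.simps)
  qed
  finally show ?case .
qed simp

section \<open>Charge\<close>

text \<open>
  In a word that is nondecreasing in the order of reading, each next letter is found without passing
  the end of the word, so the label stays \<open>0\<close>.
\<close>

lemma charge_pass_sorted:
  assumes "sorted (ys @ xs)" "\<forall>y\<in>set ys. y < a"
  shows "fst (charge_pass a 0 xs ys) = 0 \<and> sorted (snd (charge_pass a 0 xs ys))"
  using assms
proof (induction "length xs" arbitrary: a xs ys rule: less_induct)
  case less
  show ?case
  proof (cases "a \<in> set xs")
    case True
    define us where "us = takeWhile (\<lambda>x. x \<noteq> a) xs"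
    obtain vs where vs: "dropWhile (\<lambda>x. x \<noteq> a) xs = a # vs"
      using True by (metis (mono_tags, lifting) dropWhile_eq_Nil_conv hd_dropWhile list.exhaust_sel)
    have xs: "xs = us @ a # vs" using vs by (metis takeWhile_dropWhile_id us_def)
    have "a \<notin> set us" unfolding us_def by (auto dest: set_takeWhileD)
    moreover have "\<forall>x\<in>set us. x \<le> a" using less.prems(1) xs by (simp add: sorted_append)
    ultimately have "\<forall>x\<in>set us. x < a" by (metis order_le_less)
    then have "fst (charge_pass (Suc a) 0 vs (ys @ us)) = 0 \<and> sorted (snd (charge_pass (Suc a) 0 vs (ys @ us)))"
      using less.prems xs by (intro less.hyps) (auto simp: sorted_append less_Suc_eq)
    moreover have "charge_pass a 0 xs ys = map_prod ((+) 0) id (charge_pass (Suc a) 0 vs (ys @ us))"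
      using True vs by (subst charge_pass.simps) (simp add: us_def)
    ultimately show ?thesis by simp
  next
    case False
    have "a \<notin> set ys" using less.prems(2) by auto
    then have "charge_pass a 0 xs ys = (0, ys @ xs)"
      using False by (subst charge_pass.simps) simp
    then show ?thesis using less.prems(1) by simp
  qed
qed

lemma charge_rev_sorted: "sorted xs \<Longrightarrow> charge_rev xs = 0"
proof (induction xs rule: charge_rev.induct)
  case (1 xs)
  then show ?case using charge_pass_sorted[of "[]" xs 1] by (subst charge_rev.simps) auto
qed

lemma sorted_rev_reading_row_tableau: "sorted (rev (reading (row_tableau m l)))"
proof (induction m l rule: row_tableau.induct)
  case (2 m x l)
  then show ?case using reading_row_tableau_greater[of _ "Suc m" l] by (fastforce simp: reading_Cons sorted_append)
qed simp

lemma charge_row_tableau: "is_partition l \<Longrightarrow> charge (reading (row_tableau 0 l)) = 0"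
  by (simp add: charge_def evaluation_row_tableau_0 charge_rev_sorted sorted_rev_reading_row_tableau)

section \<open>Schur functions and atoms\<close>

lemma schur_weight_self:
  assumes "is_partition l"
  shows "schur l (weight l) = 1"
proof -
  have "{T. is_tableau T \<and> shape T = l \<and> mset (reading T) = weight l} = {row_tableau 0 l}"
    using row_tableau_unique is_tableau_row_tableau[OF assms] by (auto simp: weight_def)
  then show ?thesis by (simp add: schur_def)
qed

lemma schur_weight_nonzero:
  assumes "schur m (weight l) \<noteq> 0"
  shows "dominated l m"
proof -
  have "{T. is_tableau T \<and> shape T = m \<and> mset (reading T) = weight l} \<noteq> {}"
  proof
    assume "{T. is_tableau T \<and> shape T = m \<and> mset (reading T) = weight l} = {}"
    then have "schur m (weight l) = 0" unfolding schur_def by (simp only: card.empty of_nat_0)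
    then show False using assms by contradiction
  qed
  then show ?thesis using dominated_shape by blast
qed

text \<open>
  Used twice with opposite orders: a combination of Schur functions, with the coefficients of the
  monomials \<open>x\<^sup>m\<close> for \<open>f\<close>, and a combination of atoms, with the coefficients of the Schur functions
  for \<open>f\<close>. An index that is minimal among those with a nonzero factor contributes the only nonzero
  term to its own equation.
\<close>

lemma triangular_imp_zero:
  fixes a :: "'i \<Rightarrow> 'a::field"
  assumes F: "finite F"
    and zero: "\<And>m. m \<in> F \<Longrightarrow> (\<Sum>l\<in>F. a l * f l m) = 0"
    and diag: "\<And>l. l \<in> F \<Longrightarrow> f l l = 1"
    and tri: "\<And>l m. l \<in> F \<Longrightarrow> m \<in> F \<Longrightarrow> f l m \<noteq> 0 \<Longrightarrow> R l m"
    and trans: "\<And>l m n. R l m \<Longrightarrow> R m n \<Longrightarrow> R l n"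
    and antisym: "\<And>l m. l \<in> F \<Longrightarrow> m \<in> F \<Longrightarrow> R l m \<Longrightarrow> R m l \<Longrightarrow> l = m"
    and l: "l \<in> F"
  shows "a l = 0"
proof (rule ccontr)
  assume "a l \<noteq> 0"
  define S where "S = {l \<in> F. a l \<noteq> 0}"
  have "\<exists>m\<in>S. \<forall>x\<in>S. x \<noteq> m \<longrightarrow> \<not> (R x m \<and> x \<noteq> m)"
  proof (rule Finite_Set.bex_min_element)
    show "finite S" using F by (simp add: S_def)
    show "S \<noteq> {}" using l \<open>a l \<noteq> 0\<close> by (auto simp: S_def)
    show "asymp_on S (\<lambda>x y. R x y \<and> x \<noteq> y)"
      using antisym by (auto simp: asymp_on_def S_def)
    show "transp_on S (\<lambda>x y. R x y \<and> x \<noteq> y)"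
      using trans antisym unfolding transp_on_def S_def by blast
  qed
  then obtain m where m: "m \<in> F" "a m \<noteq> 0" and least: "\<And>x. x \<in> F \<Longrightarrow> a x \<noteq> 0 \<Longrightarrow> R x m \<Longrightarrow> x = m"
    by (auto simp: S_def)
  have "(\<Sum>l\<in>F. a l * f l m) = (\<Sum>l\<in>{m}. a l * f l m)"
    using F m least tri by (intro sum.mono_neutral_right) auto
  then show False using zero[OF m(1)] diag[OF m(1)] m(2) by simp
qed

lemma sum_apply: "(\<Sum>x\<in>A. f x) M = (\<Sum>x\<in>A. f x M)"
  for f :: "'b \<Rightarrow> 'c \<Rightarrow> 'd::comm_monoid_add"
  by (induction A rule: infinite_finite_induct) auto

lemma schur_independent:
  assumes "finite F" "\<forall>m\<in>F. is_partition m" "(\<Sum>m\<in>F. scale (c m) (schur m)) = 0" "m \<in> F"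
  shows "c m = 0"
proof (rule triangular_imp_zero[OF assms(1), where f = "\<lambda>l m. schur l (weight m)" and R = "\<lambda>l m. dominated m l"])
  show "(\<Sum>l\<in>F. c l * schur l (weight n)) = 0" for n
    using fun_cong[OF assms(3), of "weight n"] by (simp add: sum_apply scale_def)
qed (use assms schur_weight_self schur_weight_nonzero dominated_trans dominated_antisym in auto)

definition at_t :: "nat poly \<Rightarrow> qt" where
  "at_t p = poly (map_poly of_nat p) qt_t"

lemma at_t_add: "at_t (p + q) = at_t p + at_t q"
proof -
  have "map_poly of_nat (p + q) = map_poly (of_nat :: nat \<Rightarrow> qt) p + map_poly of_nat q"
    by (rule poly_eqI) (simp add: coeff_map_poly)
  then show ?thesis by (simp add: at_t_def)
qed

lemma at_t_0 [simp]: "at_t 0 = 0"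
  by (simp add: at_t_def)

lemma at_t_monom: "at_t (monom 1 n) = qt_t ^ n"
  by (simp add: at_t_def map_poly_monom poly_monom)

definition charge_poly :: "nat list list multiset \<Rightarrow> nat list \<Rightarrow> nat poly" where
  "charge_poly A m = (\<Sum>T\<in>#A. if shape T = m then monom 1 (charge (reading T)) else 0)"

text \<open>
  Grouping by shape; coefficients stay in \<open>\<nat>[t]\<close> since each tableau contributes one power of \<open>t\<close>.
\<close>

lemma sum_by_shape:
  assumes "finite G" "\<forall>T\<in>#A. shape T \<in> G"
  shows "(\<Sum>T\<in>#A. scale (qt_t ^ charge (reading T)) (schur (shape T))) =
    (\<Sum>m\<in>G. scale (at_t (charge_poly A m)) (schur m))"
  using assms(2)
proof (induction A)
  case empty
  then show ?case by (simp add: charge_poly_def scale_def fun_eq_iff sum_apply)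
next
  case (add T A)
  let ?X = "scale (qt_t ^ charge (reading T)) (schur (shape T))"
  have "scale (at_t (charge_poly (add_mset T A) m)) (schur m) =
      (if m = shape T then ?X else 0) +
      scale (at_t (charge_poly A m)) (schur m)" for m
    by (auto simp: charge_poly_def at_t_add at_t_monom scale_def fun_eq_iff algebra_simps
        simp del: One_nat_def)
  then have "(\<Sum>m\<in>G. scale (at_t (charge_poly (add_mset T A) m)) (schur m)) =
      (\<Sum>m\<in>G. if m = shape T then ?X else 0) + (\<Sum>m\<in>G. scale (at_t (charge_poly A m)) (schur m))"
    by (simp only: sum.distrib)
  also have "(\<Sum>m\<in>G. if m = shape T then ?X else 0) = ?X"
    using add.prems by (subst sum.delta[OF assms(1)]) simp
  finally show ?case using add by simp
qed

lemma finite_strictly_dominated: "finite {m. is_partition m \<and> strictly_dominated l m}"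
  by (rule finite_subset[OF _ finite_partitions[of "sum_list l"]])
    (auto simp: strictly_dominated_def dominated_def)

lemma atom_expansion:
  assumes "k_bounded k l"
  shows "\<exists>v. atom k l = schur l +
    (\<Sum>m | is_partition m \<and> strictly_dominated l m. scale (at_t (v m)) (schur m))"
proof -
  have l: "is_partition l" using assms by (simp add: k_bounded_def)
  let ?G = "{m. is_partition m \<and> strictly_dominated l m}"
  define A where "A = super_atom k l - {#row_tableau 0 l#}"
  have one: "count (super_atom k l) (row_tableau 0 l) = 1" using count_super_atom_row_tableau[OF assms] .
  then have "row_tableau 0 l \<in># super_atom k l" by (simp flip: count_greater_zero_iff)
  then have A: "super_atom k l = add_mset (row_tableau 0 l) A" "row_tableau 0 l \<notin># A"
    using one by (simp_all add: A_def not_in_iff)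
  have "shape T \<in> ?G" if "T \<in># A" for T
  proof -
    have T: "is_tableau T" "mset (reading T) = weight l"
      using super_atom_content[OF l, of T k] that A(1) by auto
    then have "shape T \<noteq> l" using row_tableau_unique[OF T] that A(2) by auto
    then show ?thesis
      using dominated_shape[OF T] is_partition_shape[OF T(1)] by (auto simp: strictly_dominated_def)
  qed
  then have "(\<Sum>T\<in>#A. scale (qt_t ^ charge (reading T)) (schur (shape T))) =
    (\<Sum>m\<in>?G. scale (at_t (charge_poly A m)) (schur m))" by (intro sum_by_shape finite_strictly_dominated) auto
  then have "atom k l = schur l + (\<Sum>m\<in>?G. scale (at_t (charge_poly A m)) (schur m))"
    by (simp add: atom_def A(1) charge_row_tableau[OF l])
  then show ?thesis by blast
qed

text \<open>
  Stated for combinations indexed by partitions rather than by atoms, so that it yields both the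
  linear independence and the injectivity of the indexing.
\<close>

lemma atom_combination_zero:
  assumes F: "finite F" "F \<subseteq> {l. k_bounded k l}"
    and zero: "(\<Sum>l\<in>F. scale (a l) (atom k l)) = 0" and l: "l \<in> F"
  shows "a l = 0"
proof -
  let ?D = "\<lambda>l. {m. is_partition m \<and> strictly_dominated l m}"
  have part: "is_partition l" if "l \<in> F" for l using that F(2) by (auto simp: k_bounded_def)
  have "\<forall>l\<in>F. \<exists>v. atom k l = schur l + (\<Sum>m\<in>?D l. scale (at_t (v m)) (schur m))"
    using F(2) atom_expansion by blast
  then obtain v where v: "\<And>l. l \<in> F \<Longrightarrow>
      atom k l = schur l + (\<Sum>m\<in>?D l. scale (at_t (v l m)) (schur m))"
    by metis
  \<comment> \<open>\<open>u l m\<close> is the coefficient of \<open>schur m\<close> in \<open>atom k l\<close>.\<close>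
  define u where "u l m = (if m = l then 1 else if m \<in> ?D l then at_t (v l m) else 0)" for l m
  define G where "G = F \<union> (\<Union>l\<in>F. ?D l)"
  have G: "finite G" using F(1) finite_strictly_dominated by (simp add: G_def)
  have u: "atom k l M = (\<Sum>m\<in>G. u l m * schur m M)" if l: "l \<in> F" for l M
  proof -
    have "(\<Sum>m\<in>G. u l m * schur m M) = (\<Sum>m\<in>insert l (?D l). u l m * schur m M)"
      using G l by (intro sum.mono_neutral_right) (auto simp: G_def u_def)
    also have "\<dots> = schur l M + (\<Sum>m\<in>?D l. u l m * schur m M)"
      using finite_strictly_dominated[of l]
      by (subst sum.insert) (auto simp: u_def strictly_dominated_def)
    also have "(\<Sum>m\<in>?D l. u l m * schur m M) = (\<Sum>m\<in>?D l. at_t (v l m) * schur m M)"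
      by (intro sum.cong) (auto simp: u_def strictly_dominated_def)
    finally show ?thesis using v[OF l] by (simp add: sum_apply scale_def)
  qed
  have "\<forall>m\<in>G. is_partition m" using part by (auto simp: G_def)
  moreover have "(\<Sum>m\<in>G. scale (\<Sum>l\<in>F. a l * u l m) (schur m)) = 0"
  proof
    fix M
    have "(\<Sum>m\<in>G. scale (\<Sum>l\<in>F. a l * u l m) (schur m)) M =
        (\<Sum>m\<in>G. \<Sum>l\<in>F. a l * (u l m * schur m M))"
      by (simp add: sum_apply scale_def sum_distrib_right mult.assoc)
    also have "\<dots> = (\<Sum>l\<in>F. a l * atom k l M)"
      by (subst sum.swap) (simp add: u sum_distrib_left)
    also have "\<dots> = 0" using fun_cong[OF zero, of M] by (simp add: sum_apply scale_def)
    finally show "(\<Sum>m\<in>G. scale (\<Sum>l\<in>F. a l * u l m) (schur m)) M = 0 M" by simp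
  qed
  ultimately have c: "(\<Sum>l\<in>F. a l * u l m) = 0" if "m \<in> G" for m
    using that by (rule schur_independent[OF G])
  show ?thesis
  proof (rule triangular_imp_zero[OF F(1), where f = u and R = dominated])
    show "(\<Sum>l\<in>F. a l * u l m) = 0" if "m \<in> F" for m using c that by (simp add: G_def)
    show "u l l = 1" for l by (simp add: u_def)
    show "dominated l m" if "u l m \<noteq> 0" for l m
      using that dominated_refl by (auto simp: u_def strictly_dominated_def split: if_splits)
    show "dominated l m \<Longrightarrow> dominated m n \<Longrightarrow> dominated l n" for l m n by (rule dominated_trans)
    show "l = m" if "l \<in> F" "m \<in> F" "dominated l m" "dominated m l" for l m
      using that part dominated_antisym by blast
  qed (rule l)
qed

theorem mainTheorem2:
  fixes k :: nat
  assumes "k \<ge> 1"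
  shows "inj_on (atom k) {l. k_bounded k l} \<and>
    series.independent (atom k ` {l. k_bounded k l}) \<and>
    (\<forall>l. k_bounded k l \<longrightarrow>
      (\<exists>v :: nat list \<Rightarrow> nat poly.
         atom k l = schur l +
           (\<Sum>m | is_partition m \<and> strictly_dominated l m.
              scale (poly (map_poly of_nat (v m)) qt_t) (schur m))))"
proof (intro conjI allI impI)
  show inj: "inj_on (atom k) {l. k_bounded k l}"
  proof (rule inj_onI, rule ccontr)
    fix l m assume lm: "l \<in> {l. k_bounded k l}" "m \<in> {l. k_bounded k l}" "atom k l = atom k m" "l \<noteq> m"
    define a :: "nat list \<Rightarrow> qt" where "a = (\<lambda>n. if n = l then 1 else - 1)"
    have "(\<Sum>n\<in>{l, m}. scale (a n) (atom k n)) = 0"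
      using lm by (simp add: a_def scale_def fun_eq_iff)
    then have "a l = 0" using lm atom_combination_zero[of "{l, m}" k a l] by simp
    then show False by (simp add: a_def)
  qed
  show "series.independent (atom k ` {l. k_bounded k l})"
  proof
    assume "series.dependent (atom k ` {l. k_bounded k l})"
    then obtain t u where t: "finite t" "t \<subseteq> atom k ` {l. k_bounded k l}"
      "(\<Sum>f\<in>t. scale (u f) f) = 0" and f: "\<exists>f\<in>t. u f \<noteq> 0"
      unfolding series.dependent_explicit by blast
    obtain F where F: "F \<subseteq> {l. k_bounded k l}" "finite F" "t = atom k ` F"
      using finite_subset_image[OF t(1,2)] by blast
    have "(\<Sum>l\<in>F. scale (u (atom k l)) (atom k l)) = 0"
      using t(3) F inj by (simp add: sum.reindex inj_on_subset)
    then have "u (atom k l) = 0" if "l \<in> F" for l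
      using atom_combination_zero[OF F(2,1), of "\<lambda>l. u (atom k l)" l] that by simp
    then show False using f F(3) by auto
  qed
  show "\<exists>v :: nat list \<Rightarrow> nat poly. atom k l = schur l +
      (\<Sum>m | is_partition m \<and> strictly_dominated l m.
        scale (poly (map_poly of_nat (v m)) qt_t) (schur m))" if "k_bounded k l" for l
    using atom_expansion[OF that] unfolding at_t_def .
qed

end
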